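(* For every finite alphabet $\Sigma$, $\mathbf{LMO}(\Sigma)=V_\Sigma(\overline{\mathbf{J}})=\mathrm{liId}\mathbf{PT}(\Sigma)$.
   Context: A MON-1qfa over $\Sigma$ is a tuple $A=\langle\Sigma\cup\{\#\},(O_c)_{c\in\Sigma\cup\{\#\}},\pi_0,F\rangle$, where $\pi_0\in\mathbb{C}^{1\times m}$ has norm $1$, each $O_c$ is an observable (Hermitian $m\times m$ matrix) with spectral decomposition $O_c=\sum_{r\in V(O_c)} r\,P_c(r)$ into orthogonal projectors, and $F\subseteq V(O_\#)$. For $x=x_1\cdots x_n$, with $\rho_0=\pi_0^\dagger\pi_0$ and $\rho_i=\sum_{r}P_{x_i}(r)\rho_{i-1}P_{x_i}(r)$, the acceptance probability is $p_A(x)=\sum_{r\in F}\mathrm{tr}(P_\#(r)\rho_n)$. $A$ recognizes $L$ with isolated cut-point $\lambda$ if for all $x$, $x\in L\Leftrightarrow p_A(x)>\lambda$, and there is $\delta>0$ with $|p_A(x)-\lambda|\ge\delta$ for all $x$. $\mathbf{LMO}(\Sigma)$ is the class of languages over $\Sigma$ recognized by some MON-1qfa with isolated cut-point. $V_\Sigma(\overline{\mathbf{J}})$ is the class of regular languages $L\subseteq\Sigma^*$ whose syntactic monoid $M(L)$ is $J$-trivial ($MxM=MyM\Rightarrow x=y$) and whose syntactic morphism $\phi_L:\Sigma^*\to M(L)$ satisfies $\phi_L(\sigma)^2=\phi_L(\sigma)$ for all $\sigma\in\Sigma$. $\mathrm{liId}\mathbf{PT}(\Sigma)$ (literally idempotent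 piecewise testable languages) is the boolean closure in $\Sigma^*$ of the languages $\Sigma^*a_1\Sigma^*a_2\Sigma^*\cdots\Sigma^*a_k\Sigma^*$ with $a_1,\dots,a_k\in\Sigma$ and $a_i\ne a_{i+1}$ for all $1\le i<k$. *)

theory Defs
  imports Complex_Main
begin

section \<open>Square complex matrices of dimension m, as functions on indices < m\<close>

type_synonym cmat = "nat \<Rightarrow> nat \<Rightarrow> complex"

definition mmult :: "nat \<Rightarrow> cmat \<Rightarrow> cmat \<Rightarrow> cmat" where
  "mmult m A B = (\<lambda>i j. \<Sum>k<m. A i k * B k j)"

definition meq :: "nat \<Rightarrow> cmat \<Rightarrow> cmat \<Rightarrow> bool" where
  "meq m A B \<longleftrightarrow> (\<forall>i<m. \<forall>j<m. A i j = B i j)"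

definition mid :: cmat where
  "mid = (\<lambda>i j. if i = j then 1 else 0)"

definition mzero :: cmat where
  "mzero = (\<lambda>i j. 0)"

definition mtrace :: "nat \<Rightarrow> cmat \<Rightarrow> complex" where
  "mtrace m A = (\<Sum>i<m. A i i)"

definition hermitian :: "nat \<Rightarrow> cmat \<Rightarrow> bool" where
  "hermitian m A \<longleftrightarrow> (\<forall>i<m. \<forall>j<m. A i j = cnj (A j i))"

definition orth_projector :: "nat \<Rightarrow> cmat \<Rightarrow> bool" where
  "orth_projector m P \<longleftrightarrow> hermitian m P \<and> meq m (mmult m P P) P"

text \<open>The end marker # is None; a letter c of the alphabet is Some c.
  For each symbol c, the observable obs c is given together with its spectral
  decomposition: the (finite) set of eigenvalues eigs c and the orthogonal
  projectors proj c r onto the eigenspaces.  init is the row vector pi_0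
  (entries with index < dim), acc is the set F of accepting eigenvalues of O_#.\<close>

record 'a mon_qfa =
  dim  :: nat
  init :: "nat \<Rightarrow> complex"
  obs  :: "'a option \<Rightarrow> cmat"
  eigs :: "'a option \<Rightarrow> real set"
  proj :: "'a option \<Rightarrow> real \<Rightarrow> cmat"
  acc  :: "real set"

definition is_mon_qfa :: "'a mon_qfa \<Rightarrow> bool" where
  "is_mon_qfa A \<longleftrightarrow>
     (let m = dim A in
       (\<Sum>j<m. (cmod (init A j))\<^sup>2) = 1 \<and>
       (\<forall>c. hermitian m (obs A c)
          \<and> finite (eigs A c)
          \<and> (\<forall>r\<in>eigs A c. orth_projector m (proj A c r) \<and> \<not> meq m (proj A c r) mzero)
          \<and> (\<forall>r\<in>eigs A c. \<forall>s\<in>eigs A c. r \<noteq> s \<longrightarrow>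
                meq m (mmult m (proj A c r) (proj A c s)) mzero)
          \<and> meq m (\<lambda>i j. \<Sum>r\<in>eigs A c. proj A c r i j) mid
          \<and> meq m (obs A c) (\<lambda>i j. \<Sum>r\<in>eigs A c. complex_of_real r * proj A c r i j)) \<and>
       acc A \<subseteq> eigs A None)"

definition rho0 :: "'a mon_qfa \<Rightarrow> cmat" where
  "rho0 A = (\<lambda>i j. cnj (init A i) * init A j)"

definition qstep :: "'a mon_qfa \<Rightarrow> cmat \<Rightarrow> 'a option \<Rightarrow> cmat" where
  "qstep A \<rho> c = (\<lambda>i j. \<Sum>r\<in>eigs A c.
      mmult (dim A) (mmult (dim A) (proj A c r) \<rho>) (proj A c r) i j)"

definition rho_final :: "'a mon_qfa \<Rightarrow> 'a list \<Rightarrow> cmat" where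
  "rho_final A x = foldl (qstep A) (rho0 A) (map Some x)"

definition acc_prob :: "'a mon_qfa \<Rightarrow> 'a list \<Rightarrow> real" where
  "acc_prob A x = Re (\<Sum>r\<in>acc A. mtrace (dim A) (mmult (dim A) (proj A None r) (rho_final A x)))"

definition recognizes_isolated :: "'a mon_qfa \<Rightarrow> 'a list set \<Rightarrow> bool" where
  "recognizes_isolated A L \<longleftrightarrow>
     (\<exists>cp::real. \<exists>\<delta>>0. (\<forall>x. x \<in> L \<longleftrightarrow> acc_prob A x > cp) \<and>
                      (\<forall>x. \<bar>acc_prob A x - cp\<bar> \<ge> \<delta>))"

definition LMO :: "'a list set set" where
  "LMO = {L. \<exists>A :: 'a mon_qfa. is_mon_qfa A \<and> recognizes_isolated A L}"

definition regular :: "'a list set \<Rightarrow> bool" where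
  "regular L \<longleftrightarrow> (\<exists>(Q::nat set) q0 (\<delta>::nat \<Rightarrow> 'a \<Rightarrow> nat) F.
      finite Q \<and> q0 \<in> Q \<and> (\<forall>q\<in>Q. \<forall>a. \<delta> q a \<in> Q) \<and> F \<subseteq> Q \<and>
      L = {w. foldl \<delta> q0 w \<in> F})"

definition syn_cong :: "'a list set \<Rightarrow> ('a list \<times> 'a list) set" where
  "syn_cong L = {(u, v). \<forall>x y. x @ u @ y \<in> L \<longleftrightarrow> x @ v @ y \<in> L}"

definition syn_morph :: "'a list set \<Rightarrow> 'a list \<Rightarrow> 'a list set" where
  "syn_morph L u = syn_cong L `` {u}"

definition syn_monoid :: "'a list set \<Rightarrow> 'a list set set" where
  "syn_monoid L = range (syn_morph L)"

definition syn_mult :: "'a list set \<Rightarrow> 'a list set \<Rightarrow> 'a list set \<Rightarrow> 'a list set" where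
  "syn_mult L X Y = syn_morph L ((SOME u. u \<in> X) @ (SOME v. v \<in> Y))"

definition syn_ideal :: "'a list set \<Rightarrow> 'a list set \<Rightarrow> 'a list set set" where
  "syn_ideal L X = {syn_mult L (syn_mult L P X) Q | P Q. P \<in> syn_monoid L \<and> Q \<in> syn_monoid L}"

definition J_trivial_syn :: "'a list set \<Rightarrow> bool" where
  "J_trivial_syn L \<longleftrightarrow> (\<forall>X\<in>syn_monoid L. \<forall>Y\<in>syn_monoid L.
      syn_ideal L X = syn_ideal L Y \<longrightarrow> X = Y)"

definition VJbar :: "'a list set set" where
  "VJbar = {L. regular L \<and> J_trivial_syn L \<and>
     (\<forall>\<sigma>. syn_mult L (syn_morph L [\<sigma>]) (syn_morph L [\<sigma>]) = syn_morph L [\<sigma>])}"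

fun pattern_lang :: "'a list \<Rightarrow> 'a list set" where
  "pattern_lang [] = UNIV"
| "pattern_lang (a # as) = {u @ [a] @ v | u v. v \<in> pattern_lang as}"

inductive_set bool_closure :: "'a list set set \<Rightarrow> 'a list set set" for G where
  gen: "L \<in> G \<Longrightarrow> L \<in> bool_closure G"
| compl: "L \<in> bool_closure G \<Longrightarrow> UNIV - L \<in> bool_closure G"
| union: "L \<in> bool_closure G \<Longrightarrow> K \<in> bool_closure G \<Longrightarrow> L \<union> K \<in> bool_closure G"
| inter: "L \<in> bool_closure G \<Longrightarrow> K \<in> bool_closure G \<Longrightarrow> L \<inter> K \<in> bool_closure G"

definition liIdPT :: "'a list set set" where
  "liIdPT = bool_closure {pattern_lang as | as.
      \<forall>i. Suc i < length as \<longrightarrow> as ! i \<noteq> as ! Suc i}"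

end

theory Submission
  imports Defs "HOL-Library.Sublist" "HOL-Library.FuncSet" "HOL-Library.Nat_Bijection"
begin

text \<open>
  The three inclusions \<open>LMO \<subseteq> VJbar \<subseteq> liIdPT \<subseteq> LMO\<close> close a cycle.

  Each letter of a measure-only automaton acts on density matrices as an orthogonal projection for
  the Hilbert--Schmidt inner product. Hence letters are idempotent, and the state moves only by
  losing norm. The states are bounded and the cut-point is isolated, so the language has finitely
  many derivatives; if \<open>x \<sim> x s t\<close>, then far along \<open>x (s t)\<^sup>n\<close> the word \<open>s\<close> hardly moves the state, so
  \<open>x \<sim> x s\<close>. As projections are self-adjoint, the same holds for the reversed language, and a finite
  monoid that is \<open>R\<close>- and \<open>L\<close>-trivial is \<open>J\<close>-trivial.

  The second inclusion is Simon's theorem: two words with the same short subsequences have a common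
  superword with the same short subsequences, and inserting a letter without creating a new short
  subsequence does not change the syntactic class. Idempotency of the letters allows every letter to be
  repeated, after which only subsequences without repeated adjacent letters matter.

  For the third inclusion, a measurement in a basis that is a Fourier basis on each block of a partition
  of the standard basis averages a diagonal state over the blocks. Such classical averaging automata are
  closed under complement and product, and with rapidly growing blocks they recognize the patterns
  without repeated adjacent letters with arbitrarily small error.
\<close>

section \<open>Subsequences\<close>

lemma subseq_snoc_snoc:
  "subseq (w @ [d]) (x @ [c]) \<longleftrightarrow> (if c = d then subseq w x else subseq (w @ [d]) x)"
proof (cases "c = d")
  case False
  show ?thesis
  proof
    assume "subseq (w @ [d]) (x @ [c])"
    then obtain p q where pq: "w @ [d] = p @ q" "subseq p x" "subseq q [c]"
      by (auto elim: subseq_appendE)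
    have "q = [] \<or> q = [c]"
      using pq(3) by (cases q) (auto split: if_splits)
    with pq False show "if c = d then subseq w x else subseq (w @ [d]) x"
      by auto
  next
    assume "if c = d then subseq w x else subseq (w @ [d]) x"
    with False show "subseq (w @ [d]) (x @ [c])"
      by (auto intro: subseq_rev_drop_many)
  qed
qed simp

lemma subseq_snoc_leftD: "subseq (w @ [d]) x \<Longrightarrow> subseq w x"
  by (meson prefixI prefix_imp_subseq subseq_order.trans)

lemma subseq_rev: "subseq xs ys \<Longrightarrow> subseq (rev xs) (rev ys)"
  by (induction rule: list_emb.induct)
    (auto intro: subseq_rev_drop_many simp: list_emb_append_mono)

section \<open>Simon's congruence and the insertion of letters that preserves it\<close>

definition same_subseqs :: "nat \<Rightarrow> 'a list \<Rightarrow> 'a list \<Rightarrow> bool" where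
  "same_subseqs k u v \<longleftrightarrow> (\<forall>p. length p \<le> k \<longrightarrow> subseq p u = subseq p v)"

text \<open>Every embedding of \<open>r\<close> must use the inserted \<open>b\<close>, which splits
  \<open>r\<close> there. If \<open>r1 @ [b]\<close> embedded into \<open>h\<close>, then
  \<open>r\<close> could avoid the insertion.\<close>

lemma subseq_insert_letterE:
  assumes "subseq r (h @ b # z)" "\<not> subseq r (h @ z)"
  obtains r1 r2 where "r = r1 @ b # r2" "subseq r1 h" "subseq r2 z" "\<not> subseq (r1 @ [b]) h"
proof -
  obtain r1 r' where r: "r = r1 @ r'" "subseq r1 h" "subseq r' (b # z)"
    using assms(1) by (auto elim: subseq_appendE)
  have "\<not> subseq r' z"
    using r assms(2) by (auto intro: list_emb_append_mono)
  then obtain r2 where r2: "r' = b # r2" "subseq r2 z"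
    using r(3) by (cases r') (auto split: if_splits)
  have "\<not> subseq (r1 @ [b]) h"
    using list_emb_append_mono[of "(=)" "r1 @ [b]" h r2 z] assms(2) r r2 by auto
  with r r2 show thesis
    by (auto intro: that)
qed

text \<open>Up to a leading \<open>a\<close> of \<open>r2\<close>, the mixed word
  \<open>s1 @ a # r2\<close> embeds into the left word, hence into \<open>h @ b # g\<close>. There
  \<open>h\<close> cannot hold \<open>s1 @ [a]\<close>, so the rest is matched inside
  \<open>g\<close>. This puts \<open>r2\<close> into \<open>g\<close> and carries
  \<open>r1 @ b # r2\<close> over to both words.\<close>

lemma no_mixed_witness:
  assumes same: "same_subseqs k (h @ a # f) (h @ b # g)" and "a \<noteq> b"
    and r: "subseq r1 h" "subseq r2 (a # f)" "length (r1 @ b # r2) \<le> k"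
      "\<not> subseq (r1 @ b # r2) (h @ a # f)"
    and s: "subseq s1 h" "\<not> subseq (s1 @ [a]) h" "length (s1 @ a # r2) \<le> k"
  shows False
proof -
  \<comment> \<open>\<open>q\<close> is \<open>r2\<close> without a leading \<open>a\<close>: it no
    longer touches the first difference, yet \<open>a # q\<close> still covers
    \<open>r2\<close>.\<close>
  obtain q where q: "subseq q f" "subseq r2 (a # q)" "length q \<le> length r2"
  proof (cases "\<exists>t. r2 = a # t")
    case True
    with r(2) that show ?thesis by auto
  next
    case False
    with r(2) have "subseq r2 f"
      by (cases r2) auto
    with that[of r2] show ?thesis by auto
  qed
  have "subseq (s1 @ a # q) (h @ a # f)"
    using s(1) q(1) by (auto intro: list_emb_append_mono)
  then have "subseq (s1 @ a # q) (h @ b # g)"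
    using same s(3) q(3) by (auto simp: same_subseqs_def)
  then obtain p1 p2 where p: "s1 @ a # q = p1 @ p2" "subseq p1 h" "subseq p2 (b # g)"
    by (auto elim: subseq_appendE)
  have "\<exists>us. p2 = us @ a # q"
  proof -
    from p(1) consider us where "s1 @ us = p1" "a # q = us @ p2" | us where "s1 = p1 @ us" "us @ a # q = p2"
      by (auto simp: append_eq_append_conv2)
    then show ?thesis
    proof cases
      case 1
      then have "us = []"
      proof (cases us)
        case (Cons c us')
        with 1 have "p1 = (s1 @ [a]) @ us'" by auto
        then have "subseq (s1 @ [a]) p1" by auto
        with p(2) s(2) show ?thesis using subseq_order.trans by blast
      qed
      with 1 show ?thesis by auto
    qed auto
  qed
  then have "subseq (a # q) p2" by auto
  then have "subseq (a # q) (b # g)"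
    using p(3) subseq_order.trans by blast
  with \<open>a \<noteq> b\<close> have "subseq (a # q) g" by auto
  with q(2) have "subseq r2 g"
    using subseq_order.trans by blast
  with r(1) have "subseq (r1 @ b # r2) (h @ b # g)"
    by (auto intro: list_emb_append_mono)
  with same r(3,4) show False
    by (auto simp: same_subseqs_def)
qed

lemma same_subseqs_sym: "same_subseqs k u v \<Longrightarrow> same_subseqs k v u"
  by (auto simp: same_subseqs_def)

lemma same_subseqs_trans: "same_subseqs k u v \<Longrightarrow> same_subseqs k v w \<Longrightarrow> same_subseqs k u w"
  by (auto simp: same_subseqs_def)

text \<open>If both insertions created new short subsequences, the shorter of the two tails could
  follow the head of the other witness. The mixed word then has length at most \<open>k\<close>,
  which \<open>no_mixed_witness\<close> excludes.\<close>

lemma same_subseqs_insert_first_difference: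
  assumes same: "same_subseqs k (h @ a # f) (h @ b # g)" and "a \<noteq> b"
  shows "same_subseqs k (h @ a # f) (h @ b # a # f) \<or> same_subseqs k (h @ b # g) (h @ a # b # g)"
proof (rule ccontr)
  assume contra: "\<not> ?thesis"
  have ins: "subseq (h @ z) (h @ c # z)" for c z
    by (auto intro: list_emb_append_mono)
  obtain r where r: "length r \<le> k" "subseq r (h @ b # a # f)" "\<not> subseq r (h @ a # f)"
    using contra ins[of "a # f" b] subseq_order.trans unfolding same_subseqs_def by blast
  obtain s where s: "length s \<le> k" "subseq s (h @ a # b # g)" "\<not> subseq s (h @ b # g)"
    using contra ins[of "b # g" a] subseq_order.trans unfolding same_subseqs_def by blast
  obtain r1 r2 where rr: "r = r1 @ b # r2" "subseq r1 h" "subseq r2 (a # f)" "\<not> subseq (r1 @ [b]) h"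
    using r by (auto elim: subseq_insert_letterE)
  obtain s1 s2 where ss: "s = s1 @ a # s2" "subseq s1 h" "subseq s2 (b # g)" "\<not> subseq (s1 @ [a]) h"
    using s by (auto elim: subseq_insert_letterE)
  show False
  proof (cases "length r2 \<le> length s2")
    case True
    show False
      by (rule no_mixed_witness[OF same \<open>a \<noteq> b\<close>, of r1 r2 s1]) (use r s rr ss True in auto)
  next
    case False
    show False
      by (rule no_mixed_witness[OF same_subseqs_sym[OF same] \<open>a \<noteq> b\<close>[symmetric], of s1 s2 r1])
        (use r s rr ss False in auto)
  qed
qed

text \<open>The letter at the first difference is inserted into one of the two words, which lengthens
  the common prefix; the measure is what remains after the common prefix.\<close>

lemma same_subseqs_common_superword:
  assumes "same_subseqs k (h @ u) (h @ v)"
  shows "\<exists>w. subseq (h @ u) w \<and> subseq (h @ v) w \<and> same_subseqs k (h @ u) w"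
  using assms
proof (induction "length u + length v" arbitrary: h u v rule: less_induct)
  case less
  show ?case
  proof (cases "u = [] \<or> v = []")
    case True
    then show ?thesis
    proof
      assume "u = []"
      with less.prems show ?thesis by (intro exI[of _ "h @ v"]) auto
    next
      assume "v = []"
      then show ?thesis by (intro exI[of _ "h @ u"]) (auto simp: same_subseqs_def)
    qed
  next
    case False
    then obtain a f b g where uv: "u = a # f" "v = b # g"
      by (meson neq_Nil_conv)
    show ?thesis
    proof (cases "a = b")
      case True
      with less.prems uv less.hyps[of f g "h @ [a]"] show ?thesis by auto
    next
      case ab: False
      from same_subseqs_insert_first_difference[OF less.prems[unfolded uv] ab]
      show ?thesis
      proof
        assume *: "same_subseqs k (h @ a # f) (h @ b # a # f)"
        then have "same_subseqs k ((h @ [b]) @ a # f) ((h @ [b]) @ g)"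
          using less.prems uv by (auto simp: same_subseqs_def)
        from less.hyps[OF _ this] uv obtain w where w: "subseq (h @ b # a # f) w" "subseq (h @ b # g) w"
          "same_subseqs k (h @ b # a # f) w" by auto
        have "subseq (h @ a # f) (h @ b # a # f)"
          by (auto intro: list_emb_append_mono)
        then have "subseq (h @ a # f) w"
          using w(1) subseq_order.trans by blast
        moreover have "same_subseqs k (h @ a # f) w"
          using * w(3) by (rule same_subseqs_trans)
        ultimately show ?thesis
          using w(2) uv by auto
      next
        assume *: "same_subseqs k (h @ b # g) (h @ a # b # g)"
        then have "same_subseqs k ((h @ [a]) @ f) ((h @ [a]) @ b # g)"
          using less.prems uv by (auto simp: same_subseqs_def)
        from less.hyps[OF _ this] uv obtain w where w: "subseq (h @ a # f) w" "subseq (h @ a # b # g) w"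
          "same_subseqs k (h @ a # f) w" by auto
        have "subseq (h @ b # g) (h @ a # b # g)"
          by (auto intro: list_emb_append_mono)
        then have "subseq (h @ b # g) w"
          using w(2) subseq_order.trans by blast
        with w uv show ?thesis by auto
      qed
    qed
  qed
qed

section \<open>Simon's theorem for congruences of words\<close>

text \<open>\<open>w\<close> lists the letters of \<open>x\<close> at which the class of the prefix read so far changes.\<close>

lemma change_letters:
  fixes \<phi> :: "'a list \<Rightarrow> 'm"
  assumes cong: "\<And>u v c. \<phi> u = \<phi> v \<Longrightarrow> \<phi> (u @ [c]) = \<phi> (v @ [c])"
    and Rtriv: "\<And>x s t. \<phi> (x @ s @ t) = \<phi> x \<Longrightarrow> \<phi> (x @ s) = \<phi> x"
  shows "\<exists>w. subseq w x \<and> (\<forall>d. subseq (w @ [d]) x \<longrightarrow> \<phi> (x @ [d]) = \<phi> x) \<and>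
    length w < card (\<phi> ` {p. prefix p x})"
proof (induction x rule: rev_induct)
  case Nil
  show ?case by (intro exI[of _ "[]"]) auto
next
  case (snoc c x)
  then obtain w where w: "subseq w x" "\<And>d. subseq (w @ [d]) x \<Longrightarrow> \<phi> (x @ [d]) = \<phi> x"
    "length w < card (\<phi> ` {p. prefix p x})" by auto
  have fin: "finite {p. prefix p x}" for x :: "'a list"
    using finite_set[of "prefixes x"] by (auto simp: set_prefixes_eq)
  have pre: "{p. prefix p (x @ [c])} = insert (x @ [c]) {p. prefix p x}"
    by auto
  show ?case
  proof (cases "\<phi> (x @ [c]) = \<phi> x")
    case True
    have "\<phi> ((x @ [c]) @ [d]) = \<phi> (x @ [c])" if "subseq (w @ [d]) (x @ [c])" for d
    proof (cases "c = d")
      case True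
      with \<open>\<phi> (x @ [c]) = \<phi> x\<close> cong show ?thesis by metis
    next
      case False
      with that have "subseq (w @ [d]) x" by (simp add: subseq_snoc_snoc)
      with w(2) True cong show ?thesis by metis
    qed
    moreover have "length w < card (\<phi> ` {p. prefix p (x @ [c])})"
      using w(3) card_mono[of "\<phi> ` {p. prefix p (x @ [c])}" "\<phi> ` {p. prefix p x}"] fin
      by (force simp: pre simp del: prefix_snoc)
    ultimately show ?thesis
      using w(1) by (intro exI[of _ w]) (auto intro: subseq_rev_drop_many)
  next
    case False
    have no: "\<not> subseq (w @ [c]) x"
      using w(2) False by blast
    \<comment> \<open>R-triviality: a return to the class of a prefix \<open>p\<close> would force
      the class of \<open>x\<close> to be that class too, so \<open>c\<close> would change
      nothing.\<close>
    have new: "\<phi> (x @ [c]) \<notin> \<phi> ` {p. prefix p x}"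
    proof
      assume "\<phi> (x @ [c]) \<in> \<phi> ` {p. prefix p x}"
      then obtain p s where "x = p @ s" "\<phi> (p @ s @ [c]) = \<phi> p"
        by (auto simp: prefix_def)
      with Rtriv[of p s "[c]"] False show False by auto
    qed
    \<comment> \<open>The claim about further letters is vacuous here: any embedding of
      \<open>w @ [c]\<close> uses the last position of \<open>x @ [c]\<close>.\<close>
    have "\<not> subseq ((w @ [c]) @ [d]) (x @ [c])" for d
      using no subseq_snoc_leftD[of "w @ [c]" d x] by (auto simp only: subseq_snoc_snoc split: if_splits)
    moreover have "length (w @ [c]) < card (\<phi> ` {p. prefix p (x @ [c])})"
      using w(3) new fin by (simp add: pre del: prefix_snoc)
    ultimately show ?thesis
      using w(1) by (intro exI[of _ "w @ [c]"]) auto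
  qed
qed

text \<open>Contrapositive of \<open>change_letters\<close>, with a length bound that does not
  depend on \<open>x\<close>.\<close>

lemma change_witness_right:
  fixes \<phi> :: "'a list \<Rightarrow> 'm"
  assumes "\<And>u v c. \<phi> u = \<phi> v \<Longrightarrow> \<phi> (u @ [c]) = \<phi> (v @ [c])"
    and "\<And>x s t. \<phi> (x @ s @ t) = \<phi> x \<Longrightarrow> \<phi> (x @ s) = \<phi> x"
    and "finite (range \<phi>)" and "\<phi> (x @ [d]) \<noteq> \<phi> x"
  obtains w where "subseq w x" "\<not> subseq (w @ [d]) x" "length w < card (range \<phi>)"
proof -
  obtain w where w: "subseq w x" "\<And>d. subseq (w @ [d]) x \<Longrightarrow> \<phi> (x @ [d]) = \<phi> x"
    "length w < card (\<phi> ` {p. prefix p x})"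
    using change_letters[of \<phi> x] assms(1,2) by metis
  moreover have "card (\<phi> ` {p. prefix p x}) \<le> card (range \<phi>)"
    using assms(3) by (intro card_mono) auto
  ultimately show thesis
    using that[of w] assms(4) by fastforce
qed

text \<open>The right-hand version for the map \<open>\<phi> (rev u)\<close>, under which
  L-triviality becomes R-triviality.\<close>

lemma change_witness_left:
  fixes \<phi> :: "'a list \<Rightarrow> 'm"
  assumes "\<And>u v c. \<phi> u = \<phi> v \<Longrightarrow> \<phi> (c # u) = \<phi> (c # v)"
    and "\<And>x s t. \<phi> (t @ s @ x) = \<phi> x \<Longrightarrow> \<phi> (s @ x) = \<phi> x"
    and "finite (range \<phi>)" and "\<phi> (d # x) \<noteq> \<phi> x"
  obtains w where "subseq w x" "\<not> subseq (d # w) x" "length w < card (range \<phi>)"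
proof -
  have range: "range (\<lambda>u. \<phi> (rev u)) = range \<phi>"
    by (auto simp: image_def) (metis rev_rev_ident)
  obtain w where w: "subseq w (rev x)" "\<not> subseq (w @ [d]) (rev x)" "length w < card (range \<phi>)"
  proof (rule change_witness_right[of "\<lambda>u. \<phi> (rev u)" "rev x" d])
    show "\<phi> (rev (u @ [c])) = \<phi> (rev (v @ [c]))" if "\<phi> (rev u) = \<phi> (rev v)" for u v c
      using assms(1)[OF that] by simp
    show "\<phi> (rev (y @ s)) = \<phi> (rev y)" if "\<phi> (rev (y @ s @ t)) = \<phi> (rev y)" for y s t
      using assms(2)[of "rev t" "rev s" "rev y"] that by simp
  qed (use assms(3,4) in \<open>auto simp: range\<close>)
  show thesis
    using that[of "rev w"] w subseq_rev[of w "rev x"] subseq_rev[of "d # rev w" x] by auto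
qed

text \<open>If \<open>d\<close> changed the class, it would do so both after \<open>x\<close> and
  before \<open>y\<close>. The two witnesses give a word \<open>w @ d # z\<close> shorter than
  \<open>2 * card (range \<phi>)\<close> that embeds into \<open>x @ d # y\<close>. It does not
  embed into \<open>x @ y\<close>, as a split would put \<open>w @ [d]\<close> into \<open>x\<close>
  or \<open>d # z\<close> into \<open>y\<close>.\<close>

lemma simon_insert_letter:
  fixes \<phi> :: "'a list \<Rightarrow> 'm"
  assumes cong: "\<And>u u' v v'. \<phi> u = \<phi> u' \<Longrightarrow> \<phi> v = \<phi> v' \<Longrightarrow> \<phi> (u @ v) = \<phi> (u' @ v')"
    and R: "\<And>x s t. \<phi> (x @ s @ t) = \<phi> x \<Longrightarrow> \<phi> (x @ s) = \<phi> x"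
    and L: "\<And>x s t. \<phi> (t @ s @ x) = \<phi> x \<Longrightarrow> \<phi> (s @ x) = \<phi> x"
    and fin: "finite (range \<phi>)"
    and same: "same_subseqs (2 * card (range \<phi>)) (x @ y) (x @ d # y)"
  shows "\<phi> (x @ y) = \<phi> (x @ d # y)"
proof (rule ccontr)
  assume ne: "\<phi> (x @ y) \<noteq> \<phi> (x @ d # y)"
  have "\<phi> (x @ [d]) \<noteq> \<phi> x"
    using cong[of "x @ [d]" x y y] ne by auto
  then obtain w where w: "subseq w x" "\<not> subseq (w @ [d]) x" "length w < card (range \<phi>)"
    using change_witness_right[of \<phi> x d] cong R fin by metis
  have congL: "\<phi> (c # u) = \<phi> (c # v)" if "\<phi> u = \<phi> v" for c u v
    using cong[of "[c]" "[c]" u v] that by simp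
  have "\<phi> (d # y) \<noteq> \<phi> y"
    using cong[of x x "d # y" y] ne by auto
  then obtain z where z: "subseq z y" "\<not> subseq (d # z) y" "length z < card (range \<phi>)"
    using change_witness_left[of \<phi> d y] congL L fin by metis
  have "subseq (w @ d # z) (x @ d # y)"
    using w z by (auto intro: list_emb_append_mono)
  with same w z have "subseq (w @ d # z) (x @ y)"
    by (auto simp: same_subseqs_def)
  then obtain p q where pq: "w @ d # z = p @ q" "subseq p x" "subseq q y"
    by (auto elim: subseq_appendE)
  from pq(1) consider us where "w @ us = p" "d # z = us @ q" | us where "w = p @ us" "us @ d # z = q"
    by (auto simp: append_eq_append_conv2)
  then show False
  proof cases
    case 1
    show False
    proof (cases us)
      case Nil
      with 1 pq z show False by auto
    next
      case (Cons c us')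
      with 1 have "p = (w @ [d]) @ us'" by auto
      then have "subseq (w @ [d]) p" by auto
      with pq(2) w(2) show False using subseq_order.trans by blast
    qed
  next
    case 2
    then have "subseq (d # z) q" by auto
    with pq(3) z(2) show False using subseq_order.trans by blast
  qed
qed

text \<open>The missing letters are inserted one at a time from the left, while \<open>h\<close>
  collects the part already treated. All intermediate words lie between \<open>h @ u\<close> and
  \<open>h @ w\<close>, so they share the short subsequences.\<close>

lemma simon_superword:
  fixes \<phi> :: "'a list \<Rightarrow> 'm"
  assumes cong: "\<And>u u' v v'. \<phi> u = \<phi> u' \<Longrightarrow> \<phi> v = \<phi> v' \<Longrightarrow> \<phi> (u @ v) = \<phi> (u' @ v')"
    and R: "\<And>x s t. \<phi> (x @ s @ t) = \<phi> x \<Longrightarrow> \<phi> (x @ s) = \<phi> x"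
    and L: "\<And>x s t. \<phi> (t @ s @ x) = \<phi> x \<Longrightarrow> \<phi> (s @ x) = \<phi> x"
    and fin: "finite (range \<phi>)"
    and "subseq u w" and "same_subseqs (2 * card (range \<phi>)) (h @ u) (h @ w)"
  shows "\<phi> (h @ u) = \<phi> (h @ w)"
  using assms(5,6)
proof (induction arbitrary: h rule: list_emb.induct)
  case (list_emb_Nil ys)
  then show ?case
  proof (induction ys arbitrary: h)
    case (Cons y ys)
    have sub: "subseq h (h @ [y])" "subseq (h @ [y]) (h @ y # ys)"
      by auto
    have 1: "same_subseqs (2 * card (range \<phi>)) (h @ []) (h @ [y])"
      and 2: "same_subseqs (2 * card (range \<phi>)) ((h @ [y]) @ []) ((h @ [y]) @ ys)"
      using Cons.prems sub subseq_order.trans unfolding same_subseqs_def append_assoc append_Nil append_Nil2 append_Cons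
      by blast+
    have "\<phi> (h @ []) = \<phi> (h @ [y])"
      by (rule simon_insert_letter[where \<phi> = \<phi>]) (fact cong R L fin 1)+
    with Cons.IH[OF 2] show ?case by simp
  qed simp
next
  case (list_emb_Cons xs ys y)
  have sub: "subseq (h @ xs) (h @ y # xs)" "subseq (h @ y # xs) (h @ y # ys)"
    using list_emb_Cons.hyps by (auto intro: list_emb_append_mono)
  have 1: "same_subseqs (2 * card (range \<phi>)) (h @ xs) (h @ y # xs)"
    and 2: "same_subseqs (2 * card (range \<phi>)) ((h @ [y]) @ xs) ((h @ [y]) @ ys)"
    using list_emb_Cons.prems sub subseq_order.trans unfolding same_subseqs_def append_assoc append_Nil append_Cons
    by blast+
  have "\<phi> (h @ xs) = \<phi> (h @ y # xs)"
    by (rule simon_insert_letter[where \<phi> = \<phi>]) (fact cong R L fin 1)+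
  with list_emb_Cons.IH[OF 2] show ?case by simp
next
  case (list_emb_Cons2 x y xs ys)
  then show ?case
    using list_emb_Cons2.IH[of "h @ [x]"] by simp
qed

text \<open>Both words can be enlarged to one common superword without leaving their class.\<close>

theorem simon_congruence:
  fixes \<phi> :: "'a list \<Rightarrow> 'm"
  assumes "\<And>u u' v v'. \<phi> u = \<phi> u' \<Longrightarrow> \<phi> v = \<phi> v' \<Longrightarrow> \<phi> (u @ v) = \<phi> (u' @ v')"
    and "\<And>x s t. \<phi> (x @ s @ t) = \<phi> x \<Longrightarrow> \<phi> (x @ s) = \<phi> x"
    and "\<And>x s t. \<phi> (t @ s @ x) = \<phi> x \<Longrightarrow> \<phi> (s @ x) = \<phi> x"
    and "finite (range \<phi>)"
    and same: "same_subseqs (2 * card (range \<phi>)) u v"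
  shows "\<phi> u = \<phi> v"
proof -
  obtain w where w: "subseq u w" "subseq v w" "same_subseqs (2 * card (range \<phi>)) u w"
    using same_subseqs_common_superword[of _ "[]" u v] same by auto
  have vw: "same_subseqs (2 * card (range \<phi>)) v w"
    using same w(3) by (auto simp: same_subseqs_def)
  have "\<phi> ([] @ u) = \<phi> ([] @ w)"
    by (rule simon_superword[OF assms(1-4)]) (use w in auto)
  moreover have "\<phi> ([] @ v) = \<phi> ([] @ w)"
    by (rule simon_superword[OF assms(1-4)]) (use w vw in auto)
  ultimately show ?thesis by simp
qed

section \<open>The syntactic monoid\<close>

lemma syn_morph_eq_iff:
  "syn_morph L u = syn_morph L v \<longleftrightarrow> (\<forall>x y. x @ u @ y \<in> L \<longleftrightarrow> x @ v @ y \<in> L)"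
proof
  assume "syn_morph L u = syn_morph L v"
  moreover have "v \<in> syn_morph L v"
    by (simp add: syn_morph_def syn_cong_def)
  ultimately have "v \<in> syn_morph L u" by simp
  then show "\<forall>x y. x @ u @ y \<in> L \<longleftrightarrow> x @ v @ y \<in> L"
    by (simp add: syn_morph_def syn_cong_def)
next
  assume "\<forall>x y. x @ u @ y \<in> L \<longleftrightarrow> x @ v @ y \<in> L"
  then show "syn_morph L u = syn_morph L v"
    by (simp add: syn_morph_def syn_cong_def)
qed

lemma syn_morph_append_cong:
  assumes "syn_morph L u = syn_morph L u'" "syn_morph L v = syn_morph L v'"
  shows "syn_morph L (u @ v) = syn_morph L (u' @ v')"
proof -
  have "x @ (u @ v) @ y \<in> L \<longleftrightarrow> x @ (u' @ v') @ y \<in> L" for x y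
  proof -
    have "x @ u @ (v @ y) \<in> L \<longleftrightarrow> x @ u' @ (v @ y) \<in> L"
      using assms(1) unfolding syn_morph_eq_iff by blast
    moreover have "(x @ u') @ v @ y \<in> L \<longleftrightarrow> (x @ u') @ v' @ y \<in> L"
      using assms(2) unfolding syn_morph_eq_iff by blast
    ultimately show ?thesis by simp
  qed
  then show ?thesis
    unfolding syn_morph_eq_iff by blast
qed

text \<open>\<open>syn_mult\<close> picks representatives with \<open>SOME\<close>; the congruence
  property makes the choice irrelevant.\<close>

lemma syn_mult_syn_morph: "syn_mult L (syn_morph L u) (syn_morph L v) = syn_morph L (u @ v)"
proof -
  have "syn_morph L (SOME w. w \<in> syn_morph L u) = syn_morph L u" for u
  proof -
    have "u \<in> syn_morph L u"
      by (auto simp: syn_morph_def syn_cong_def)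
    then have "(SOME w. w \<in> syn_morph L u) \<in> syn_morph L u"
      by (rule someI)
    then have "(u, SOME w. w \<in> syn_morph L u) \<in> syn_cong L"
      by (simp add: syn_morph_def)
    then show ?thesis
      unfolding syn_morph_eq_iff by (simp add: syn_cong_def)
  qed
  then show ?thesis
    unfolding syn_mult_def by (intro syn_morph_append_cong)
qed

lemma syn_ideal_syn_morph: "syn_ideal L (syn_morph L u) = {syn_morph L (p @ u @ q) | p q. True}"
proof -
  have "syn_ideal L (syn_morph L u) =
      {syn_mult L (syn_mult L (syn_morph L p) (syn_morph L u)) (syn_morph L q) | p q. True}"
    unfolding syn_ideal_def syn_monoid_def by blast
  then show ?thesis
    by (simp add: syn_mult_syn_morph)
qed

lemma J_trivial_syn_iff:
  "J_trivial_syn L \<longleftrightarrow> (\<forall>u v. {syn_morph L (p @ u @ q) | p q. True} = {syn_morph L (p @ v @ q) | p q. True}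
     \<longrightarrow> syn_morph L u = syn_morph L v)"
  unfolding J_trivial_syn_def syn_monoid_def by (auto simp: syn_ideal_syn_morph)

text \<open>Each of the two classes is a factor of the other, so they generate the same
  ideal.\<close>

lemma syn_morph_factor_eq:
  assumes J: "J_trivial_syn L"
    and "syn_morph L (p @ u @ q) = syn_morph L v" "syn_morph L (p' @ v @ q') = syn_morph L u"
  shows "syn_morph L u = syn_morph L v"
proof -
  have "syn_morph L (a @ u @ b) = syn_morph L ((a @ p') @ v @ (q' @ b))"
    and "syn_morph L (a @ v @ b) = syn_morph L ((a @ p) @ u @ (q @ b))" for a b
    using assms(2,3) by (smt (verit, best) append_assoc syn_morph_append_cong)+
  then have "{syn_morph L (p @ u @ q) | p q. True} = {syn_morph L (p @ v @ q) | p q. True}"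
    by blast
  with J show ?thesis
    unfolding J_trivial_syn_iff by blast
qed

lemma J_trivial_syn_right:
  assumes "J_trivial_syn L" "syn_morph L (x @ s @ t) = syn_morph L x"
  shows "syn_morph L (x @ s) = syn_morph L x"
  using syn_morph_factor_eq[OF assms(1), of "[]" "x @ s" t x "[]" s] assms(2) by simp

lemma J_trivial_syn_left:
  assumes "J_trivial_syn L" "syn_morph L (t @ s @ x) = syn_morph L x"
  shows "syn_morph L (s @ x) = syn_morph L x"
  using syn_morph_factor_eq[OF assms(1), of t "s @ x" "[]" x s "[]"] assms(2) by simp

lemma finite_range_factor:
  assumes "finite (range f)" "\<And>x y. f x = f y \<Longrightarrow> g x = g y"
  shows "finite (range g)"
proof -
  have "g x = g (SOME y. f y = f x)" for x
    by (rule assms(2)) (metis (mono_tags) someI)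
  then have "range g \<subseteq> (\<lambda>a. g (SOME y. f y = a)) ` range f"
    by (auto simp: image_def)
  with assms(1) show ?thesis
    by (meson finite_imageI finite_subset)
qed

text \<open>A word acts as a map from \<open>Q\<close> to itself, and words with the same action are
  syntactically equivalent. There are only finitely many such maps.\<close>

lemma regular_finite_syn_monoid:
  assumes "regular L"
  shows "finite (range (syn_morph L))"
proof -
  obtain Q :: "nat set" and q0 \<delta> F where Q: "finite Q" "q0 \<in> Q" "\<And>q a. q \<in> Q \<Longrightarrow> \<delta> q a \<in> Q"
    and L: "L = {w. foldl \<delta> q0 w \<in> F}"
    using assms unfolding regular_def by metis
  have run: "foldl \<delta> q w \<in> Q" if "q \<in> Q" for q w
    using that Q(3) by (induction w arbitrary: q) auto
  define act where "act w = (\<lambda>q\<in>Q. foldl \<delta> q w)" for w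
  have same: "syn_morph L u = syn_morph L v" if "act u = act v" for u v
  proof -
    have "foldl \<delta> q u = foldl \<delta> q v" if "q \<in> Q" for q
      using \<open>act u = act v\<close> that unfolding act_def by (metis restrict_apply')
    then show ?thesis
      unfolding syn_morph_eq_iff using Q(2) run by (auto simp: L)
  qed
  have "range act \<subseteq> Q \<rightarrow>\<^sub>E Q"
    by (auto simp: act_def run)
  then have "finite (range act)"
    using Q(1) by (meson finite_PiE finite_subset)
  then show ?thesis
    using same by (rule finite_range_factor)
qed

section \<open>Literally idempotent languages\<close>

lemma pattern_lang_subseq: "pattern_lang as = {w. subseq as w}"
proof (induction as)
  case (Cons a as)
  have "subseq (a # as) w \<longleftrightarrow> (\<exists>u v. w = u @ [a] @ v \<and> subseq as v)" for w
    using list_emb_ConsD[of "(=)" a as w] by (auto intro: list_emb_append2)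
  with Cons show ?case by auto
qed simp

text \<open>When letters are idempotent, stuttering with positive \<open>k\<close> keeps the class
  of a word. It also makes the short subsequences depend only on those without repeated adjacent
  letters.\<close>

definition stutter :: "nat \<Rightarrow> 'a list \<Rightarrow> 'a list" where
  "stutter k u = concat (map (replicate k) u)"

lemma stutter_simps [simp]: "stutter k [] = []" "stutter k (a # u) = replicate k a @ stutter k u"
  by (simp_all add: stutter_def)

lemma subseq_stutter_mono: "subseq u v \<Longrightarrow> subseq (stutter k u) (stutter k v)"
  by (induction rule: list_emb.induct) (auto intro: list_emb_append_mono)

text \<open>A run of equal letters in \<open>p\<close> is no longer than \<open>k\<close>, so it
  fits into a single block.\<close>

lemma subseq_stutter_remdups_adj: "length p \<le> k \<Longrightarrow> subseq p (stutter k (remdups_adj p))"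
proof (induction p arbitrary: k rule: remdups_adj.induct)
  case (2 x)
  then show ?case by (cases k) auto
next
  case (3 x y xs)
  show ?case
  proof (cases "x = y")
    case True
    obtain j where k: "k = Suc j" using "3.prems" by (cases k) auto
    \<comment> \<open>One copy is given up in every block when embedding the tail; the first block
      then has room for the additional \<open>x\<close>.\<close>
    have mono: "subseq (x # stutter j v) (stutter (Suc j) v)" if "v \<noteq> [] \<and> hd v = x" for v
    proof -
      have "subseq (stutter j v) (stutter (Suc j) v)" for v :: "'a list"
        by (induction v) (auto intro: list_emb_append_mono)
      with that show ?thesis by (cases v) (auto intro: list_emb_append_mono)
    qed
    have "subseq (y # xs) (stutter j (remdups_adj (y # xs)))"
      using "3.IH"(1)[OF True, of j] "3.prems" k True by simp
    then have "subseq (x # y # xs) (x # stutter j (remdups_adj (y # xs)))"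
      by auto
    moreover have "subseq (x # stutter j (remdups_adj (y # xs))) (stutter k (remdups_adj (y # xs)))"
      unfolding k by (rule mono) (use True in simp)
    ultimately have "subseq (x # y # xs) (stutter k (remdups_adj (y # xs)))"
      by (rule subseq_order.trans)
    with True show ?thesis by simp
  next
    case False
    then have "subseq (y # xs) (stutter k (remdups_adj (y # xs)))"
      using "3.IH"(2)[OF False, of k] "3.prems" by simp
    moreover have "subseq [x] (replicate k x)"
      using "3.prems" by (cases k) auto
    ultimately have "subseq ([x] @ y # xs) (replicate k x @ stutter k (remdups_adj (y # xs)))"
      using list_emb_append_mono by blast
    with False show ?thesis by simp
  qed
qed simp

text \<open>The part of \<open>p\<close> matched inside one block is a power of one letter, which
  contributes at most one letter after \<open>remdups_adj\<close>.\<close>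

lemma remdups_adj_subseq_stutterD: "subseq p (stutter k u) \<Longrightarrow> subseq (remdups_adj p) u"
proof (induction u arbitrary: p)
  case (Cons a u)
  then obtain p1 p2 where p: "p = p1 @ p2" "subseq p1 (replicate k a)" "subseq p2 (stutter k u)"
    by (auto elim: subseq_appendE)
  have "set p1 \<subseteq> {a}"
    using p(2) by (auto elim!: list_emb_set dest: in_set_replicate[THEN iffD1])
  then have "p1 = replicate (length p1) a"
    by (induction p1) auto
  then obtain j where j: "p1 = replicate j a" by blast
  have "remdups_adj (replicate j a @ p2) = remdups_adj p2 \<or>
      remdups_adj (replicate j a @ p2) = a # remdups_adj p2"
    by (induction j) (auto simp: remdups_adj_Cons split: list.splits)
  moreover have "subseq (remdups_adj p2) u"
    using p(3) by (rule Cons.IH)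
  ultimately show ?case
    unfolding p(1) j by auto
qed (auto dest: list_emb_Nil2)

text \<open>For \<open>length p \<le> k\<close>, \<open>p\<close> embeds into
  \<open>stutter k u\<close> exactly if \<open>remdups_adj p\<close> embeds into
  \<open>u\<close>.\<close>

lemma same_subseqs_stutter:
  assumes "\<And>p. length p \<le> k \<Longrightarrow> (\<forall>i. Suc i < length p \<longrightarrow> p ! i \<noteq> p ! Suc i) \<Longrightarrow> subseq p u = subseq p v"
  shows "same_subseqs k (stutter k u) (stutter k v)"
proof -
  have "subseq p (stutter k u) \<longleftrightarrow> subseq (remdups_adj p) u" if "length p \<le> k" for p and u :: "'a list"
    using remdups_adj_subseq_stutterD subseq_stutter_remdups_adj[OF that]
      subseq_stutter_mono subseq_order.trans by metis
  moreover have "subseq (remdups_adj p) u = subseq (remdups_adj p) v" if "length p \<le> k" for p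
    by (intro assms allI impI remdups_adj_adjacent order_trans[OF remdups_adj_length that])
  ultimately show ?thesis
    by (simp add: same_subseqs_def)
qed

text \<open>Induction on \<open>P\<close>: \<open>L\<close> is cut along one set \<open>K p\<close>,
  and each half is described by the remaining sets.\<close>

lemma bool_closure_saturated:
  assumes "finite P" "UNIV \<in> bool_closure G" "\<And>p. p \<in> P \<Longrightarrow> K p \<in> bool_closure G"
    and "\<And>u v. (\<And>p. p \<in> P \<Longrightarrow> u \<in> K p \<longleftrightarrow> v \<in> K p) \<Longrightarrow> u \<in> L \<Longrightarrow> v \<in> L"
  shows "L \<in> bool_closure G"
  using assms(1,3,4)
proof (induction P arbitrary: L rule: finite_induct)
  case empty
  have "L = UNIV \<or> L = UNIV - UNIV"
    using empty by blast
  with assms(2) bool_closure.compl[OF assms(2)] show ?case by metis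
next
  case (insert p P)
  \<comment> \<open>\<open>sat A\<close> is the closure of \<open>A\<close> under agreement on the
    remaining sets, so the induction hypothesis applies to it.\<close>
  define sat where "sat A = {v. \<exists>u\<in>A. \<forall>q\<in>P. u \<in> K q \<longleftrightarrow> v \<in> K q}" for A
  have sat: "sat A \<in> bool_closure G" for A
    by (rule insert.IH) (use insert.prems(1) in \<open>auto simp: sat_def\<close>)
  have "L = (sat (L \<inter> K p) \<inter> K p) \<union> (sat (L - K p) \<inter> (UNIV - K p))"
  proof (intro set_eqI iffI)
    fix v assume "v \<in> L"
    then show "v \<in> (sat (L \<inter> K p) \<inter> K p) \<union> (sat (L - K p) \<inter> (UNIV - K p))"
      unfolding sat_def by blast
  next
    fix v assume "v \<in> (sat (L \<inter> K p) \<inter> K p) \<union> (sat (L - K p) \<inter> (UNIV - K p))"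
    then obtain u where "u \<in> L" "\<And>q. q \<in> insert p P \<Longrightarrow> u \<in> K q \<longleftrightarrow> v \<in> K q"
      unfolding sat_def by blast
    then show "v \<in> L"
      using insert.prems(2) by blast
  qed
  also have "\<dots> \<in> bool_closure G"
    by (intro bool_closure.union bool_closure.inter bool_closure.compl sat) (simp_all add: insert.prems(1))
  finally show ?case .
qed

theorem VJbar_subset_liIdPT: "(VJbar :: ('a::finite) list set set) \<subseteq> liIdPT"
proof
  fix L :: "'a list set"
  assume "L \<in> VJbar"
  then have reg: "regular L" and J: "J_trivial_syn L"
    and idem: "\<And>a. syn_morph L [a, a] = syn_morph L [a]"
    by (auto simp: VJbar_def syn_mult_syn_morph)
  \<comment> \<open>Simon's theorem asks for \<open>2 * card\<close>; the successor makes
    \<open>k\<close> positive, so that stuttering erases no letter.\<close>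
  define k where "k = Suc (2 * card (range (syn_morph L)))"
  have replicate: "syn_morph L (replicate (Suc n) a) = syn_morph L [a]" for n a
  proof (induction n)
    case (Suc n)
    have "syn_morph L ([a] @ replicate (Suc n) a) = syn_morph L ([a] @ [a])"
      by (intro syn_morph_append_cong) (use Suc in auto)
    with idem show ?case by simp
  qed simp
  have stutter: "syn_morph L (stutter k u) = syn_morph L u" for u
  proof (induction u)
    case (Cons a u)
    have "syn_morph L (replicate k a @ stutter k u) = syn_morph L ([a] @ u)"
      unfolding k_def by (intro syn_morph_append_cong replicate Cons[unfolded k_def])
    then show ?case by simp
  qed simp
  define P :: "'a list set" where
    "P = {p. length p \<le> k \<and> (\<forall>i. Suc i < length p \<longrightarrow> p ! i \<noteq> p ! Suc i)}"
  \<comment> \<open>The finiteness of the alphabet enters here.\<close>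
  have "P \<subseteq> {p. set p \<subseteq> UNIV \<and> length p \<le> k}"
    by (auto simp: P_def)
  then have finP: "finite P"
    by (rule finite_subset) (rule finite_lists_length_le, simp)
  have genP: "pattern_lang p \<in> bool_closure {pattern_lang as | as. \<forall>i. Suc i < length as \<longrightarrow> as ! i \<noteq> as ! Suc i}"
    if "p \<in> P" for p
    using that by (intro bool_closure.gen) (auto simp: P_def)
  have "L \<in> bool_closure {pattern_lang as | as. \<forall>i. Suc i < length as \<longrightarrow> as ! i \<noteq> as ! Suc i}"
  proof (rule bool_closure_saturated[OF finP _ genP])
    show "UNIV \<in> bool_closure {pattern_lang as | as. \<forall>i. Suc i < length as \<longrightarrow> (as::'a list) ! i \<noteq> as ! Suc i}"
      using genP[of "[]"] by (simp add: P_def)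
  next
    fix u v assume uv: "\<And>p. p \<in> P \<Longrightarrow> u \<in> pattern_lang p \<longleftrightarrow> v \<in> pattern_lang p" and "u \<in> L"
    have "same_subseqs k (stutter k u) (stutter k v)"
      using uv by (intro same_subseqs_stutter) (auto simp: P_def pattern_lang_subseq)
    then have "same_subseqs (2 * card (range (syn_morph L))) (stutter k u) (stutter k v)"
      by (auto simp: same_subseqs_def k_def)
    then have "syn_morph L (stutter k u) = syn_morph L (stutter k v)"
      by (rule simon_congruence[where \<phi> = "syn_morph L", rotated -1])
        (fact syn_morph_append_cong J_trivial_syn_right[OF J] J_trivial_syn_left[OF J]
          regular_finite_syn_monoid[OF reg])+
    then have "syn_morph L u = syn_morph L v"
      by (simp add: stutter)
    then have "[] @ u @ [] \<in> L \<longleftrightarrow> [] @ v @ [] \<in> L"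
      unfolding syn_morph_eq_iff by blast
    with \<open>u \<in> L\<close> show "v \<in> L" by simp
  qed
  then show "L \<in> liIdPT"
    by (simp add: liIdPT_def)
qed

section \<open>Languages recognized by orthogonal projections\<close>

definition hs_inner :: "nat \<Rightarrow> cmat \<Rightarrow> cmat \<Rightarrow> complex" where
  "hs_inner m X Y = (\<Sum>i<m. \<Sum>j<m. X i j * cnj (Y i j))"

definition hs_normsq :: "nat \<Rightarrow> cmat \<Rightarrow> real" where
  "hs_normsq m X = (\<Sum>i<m. \<Sum>j<m. (cmod (X i j))\<^sup>2)"

lemma hs_inner_self: "hs_inner m X X = of_real (hs_normsq m X)"
  by (simp add: hs_inner_def hs_normsq_def complex_norm_square[symmetric])

lemma hs_inner_cnj: "hs_inner m X Y = cnj (hs_inner m Y X)"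
  by (simp add: hs_inner_def mult.commute)

lemma hs_inner_diff_left:
  "hs_inner m (\<lambda>i j. X i j - Y i j) Z = hs_inner m X Z - hs_inner m Y Z"
  by (simp add: hs_inner_def left_diff_distrib sum_subtractf)

lemma hs_inner_diff_right:
  "hs_inner m Z (\<lambda>i j. X i j - Y i j) = hs_inner m Z X - hs_inner m Z Y"
  by (simp add: hs_inner_def right_diff_distrib sum_subtractf)

lemma hs_normsq_nonneg: "0 \<le> hs_normsq m X"
  by (simp add: hs_normsq_def sum_nonneg)

lemma cmod_entry_le_hs_norm:
  assumes "i < m" "j < m"
  shows "cmod (X i j) \<le> sqrt (hs_normsq m X)"
proof -
  have "(cmod (X i j))\<^sup>2 \<le> (\<Sum>j<m. (cmod (X i j))\<^sup>2)"
    using assms by (intro member_le_sum) auto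
  also have "\<dots> \<le> hs_normsq m X"
    unfolding hs_normsq_def using assms
    by (intro member_le_sum[of i "{..<m}" "\<lambda>i. \<Sum>j<m. (cmod (X i j))\<^sup>2"]) (auto intro: sum_nonneg)
  finally show ?thesis
    by (simp add: real_le_rsqrt)
qed

text \<open>A crude Lipschitz constant for the functional given by \<open>Y\<close>, in place of the
  norm that Cauchy-Schwarz would yield.\<close>

definition entry_bound :: "nat \<Rightarrow> cmat \<Rightarrow> real" where
  "entry_bound m Y = (\<Sum>i<m. \<Sum>j<m. cmod (Y i j))"

lemma entry_bound_nonneg: "0 \<le> entry_bound m Y"
  by (simp add: entry_bound_def sum_nonneg)

lemma cmod_hs_inner_le: "cmod (hs_inner m X Y) \<le> entry_bound m Y * sqrt (hs_normsq m X)"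
proof -
  have "cmod (hs_inner m X Y) \<le> (\<Sum>i<m. \<Sum>j<m. cmod (X i j) * cmod (Y i j))"
    unfolding hs_inner_def
    by (intro order_trans[OF norm_sum] sum_mono) (simp add: norm_mult)
  also have "\<dots> \<le> (\<Sum>i<m. \<Sum>j<m. sqrt (hs_normsq m X) * cmod (Y i j))"
    by (intro sum_mono mult_right_mono cmod_entry_le_hs_norm) auto
  finally show ?thesis
    by (simp add: entry_bound_def sum_distrib_left sum_distrib_right mult.commute)
qed

text \<open>Idempotency is stated through the inner product because matrices are functions on all
  indices, and only the entries below \<open>m\<close> are controlled.\<close>

definition hs_projection :: "nat \<Rightarrow> (cmat \<Rightarrow> cmat) \<Rightarrow> bool" where
  "hs_projection m T \<longleftrightarrow>
     (\<forall>X Y. T (\<lambda>i j. X i j - Y i j) = (\<lambda>i j. T X i j - T Y i j)) \<and>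
     (\<forall>X Y. hs_inner m (T X) Y = hs_inner m X (T Y)) \<and>
     (\<forall>X Y. hs_inner m (T (T X)) Y = hs_inner m (T X) Y)"

text \<open>Self-adjointness and idempotency identify both mixed products with
  \<open>hs_inner m (T X) (T X)\<close>. Thus the loss of squared norm measures how far the state
  moves.\<close>

lemma hs_projection_pythagoras:
  assumes "hs_projection m T"
  shows "hs_normsq m (\<lambda>i j. X i j - T X i j) = hs_normsq m X - hs_normsq m (T X)"
proof -
  have sa: "hs_inner m (T X) Y = hs_inner m X (T Y)" and idem: "hs_inner m (T (T X)) Y = hs_inner m (T X) Y" for X Y
    using assms by (auto simp: hs_projection_def)
  have "hs_inner m (T X) (T X) = hs_inner m (T X) X"
    using sa[of "T X" X] idem by simp
  moreover have "hs_inner m X (T X) = hs_inner m (T X) X"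
    using sa by simp
  ultimately have "hs_inner m (\<lambda>i j. X i j - T X i j) (\<lambda>i j. X i j - T X i j)
      = hs_inner m X X - hs_inner m (T X) (T X)"
    by (simp add: hs_inner_diff_left hs_inner_diff_right)
  then have "complex_of_real (hs_normsq m (\<lambda>i j. X i j - T X i j)) =
      complex_of_real (hs_normsq m X - hs_normsq m (T X))"
    by (simp add: hs_inner_self)
  then show ?thesis
    by (simp only: of_real_eq_iff)
qed

section \<open>Words acting as products of projections\<close>

definition op_run :: "('a \<Rightarrow> cmat \<Rightarrow> cmat) \<Rightarrow> cmat \<Rightarrow> 'a list \<Rightarrow> cmat" where
  "op_run T v x = foldl (\<lambda>X c. T c X) v x"

lemma op_run_simps [simp]: "op_run T v [] = v" "op_run T v (c # x) = op_run T (T c v) x"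
  "op_run T v (x @ y) = op_run T (op_run T v x) y"
  by (simp_all add: op_run_def)

lemma op_run_diff:
  assumes "\<And>c. hs_projection m (T c)"
  shows "op_run T (\<lambda>i j. X i j - Y i j) x = (\<lambda>i j. op_run T X x i j - op_run T Y x i j)"
proof (induction x arbitrary: X Y)
  case (Cons c x)
  have "T c (\<lambda>i j. X i j - Y i j) = (\<lambda>i j. T c X i j - T c Y i j)"
    using assms[of c] by (simp add: hs_projection_def)
  with Cons show ?case by simp
qed simp

lemma hs_normsq_op_run_le:
  assumes "\<And>c. hs_projection m (T c)"
  shows "hs_normsq m (op_run T v x) \<le> hs_normsq m v"
proof (induction x arbitrary: v)
  case (Cons c x)
  have "hs_normsq m (T c v) \<le> hs_normsq m v"
    using hs_projection_pythagoras[OF assms[of c], of v] hs_normsq_nonneg[of m "\<lambda>i j. v i j - T c v i j"] by simp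
  with Cons[of "T c v"] show ?case by simp
qed simp

text \<open>Self-adjoint operators pass to the other argument one by one, which reverses their
  order.\<close>

lemma hs_inner_op_run_rev:
  assumes "\<And>c. hs_projection m (T c)"
  shows "hs_inner m (op_run T v x) e = hs_inner m v (op_run T e (rev x))"
proof (induction x arbitrary: v)
  case (Cons c x)
  then show ?case
    using assms[of c] by (simp add: hs_projection_def)
qed simp

text \<open>By linearity the difference of two states evolves like a state, and projections do not
  increase its norm.\<close>

lemma hs_inner_op_run_dist:
  assumes "\<And>c. hs_projection m (T c)"
  shows "cmod (hs_inner m (op_run T X z) e - hs_inner m (op_run T Y z) e) \<le>
    entry_bound m e * sqrt (hs_normsq m (\<lambda>i j. X i j - Y i j))"
proof -
  have "hs_inner m (op_run T X z) e - hs_inner m (op_run T Y z) e =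
      hs_inner m (op_run T (\<lambda>i j. X i j - Y i j) z) e"
    by (simp add: op_run_diff[OF assms] hs_inner_diff_left)
  also have "cmod \<dots> \<le> entry_bound m e * sqrt (hs_normsq m (op_run T (\<lambda>i j. X i j - Y i j) z))"
    by (rule cmod_hs_inner_le)
  also have "\<dots> \<le> entry_bound m e * sqrt (hs_normsq m (\<lambda>i j. X i j - Y i j))"
    by (intro mult_left_mono real_sqrt_le_mono hs_normsq_op_run_le assms entry_bound_nonneg)
  finally show ?thesis .
qed

text \<open>Telescoping over the letters of \<open>s\<close>: each letter moves the state by the
  square root of the squared norm it loses, and this loss is at most the total one.\<close>

lemma hs_inner_op_run_energy:
  assumes "\<And>c. hs_projection m (T c)"
  shows "cmod (hs_inner m (op_run T X z) e - hs_inner m (op_run T (op_run T X s) z) e) \<le>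
    length s * (entry_bound m e * sqrt (hs_normsq m X - hs_normsq m (op_run T X s)))"
proof (induction s arbitrary: X)
  case (Cons c s)
  let ?f = "\<lambda>X. hs_inner m (op_run T X z) e"
  let ?D = "sqrt (hs_normsq m X - hs_normsq m (op_run T X (c # s)))"
  have le: "hs_normsq m (op_run T X (c # s)) \<le> hs_normsq m (T c X)" "hs_normsq m (T c X) \<le> hs_normsq m X"
    using hs_normsq_op_run_le[OF assms, where v = "T c X" and x = s]
      hs_normsq_op_run_le[OF assms, where v = X and x = "[c]"] by auto
  have "cmod (?f X - ?f (T c X)) \<le> entry_bound m e * sqrt (hs_normsq m X - hs_normsq m (T c X))"
    using hs_inner_op_run_dist[OF assms, where X = X and Y = "T c X" and z = z and e = e] hs_projection_pythagoras[OF assms] by simp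
  also have "\<dots> \<le> entry_bound m e * ?D"
    using le by (intro mult_left_mono entry_bound_nonneg) auto
  finally have 1: "cmod (?f X - ?f (T c X)) \<le> entry_bound m e * ?D" .
  have "cmod (?f (T c X) - ?f (op_run T (T c X) s)) \<le>
      length s * (entry_bound m e * sqrt (hs_normsq m (T c X) - hs_normsq m (op_run T (T c X) s)))"
    by (rule Cons)
  also have "\<dots> \<le> length s * (entry_bound m e * ?D)"
    using le by (intro mult_left_mono entry_bound_nonneg) auto
  finally have 2: "cmod (?f (T c X) - ?f (op_run T (T c X) s)) \<le> length s * (entry_bound m e * ?D)" .
  have "cmod (?f X - ?f (op_run T X (c # s))) \<le>
      cmod (?f X - ?f (T c X)) + cmod (?f (T c X) - ?f (op_run T (T c X) s))"
    using norm_triangle_ineq[of "?f X - ?f (T c X)" "?f (T c X) - ?f (op_run T (T c X) s)"] by simp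
  also have "\<dots> \<le> length (c # s) * (entry_bound m e * ?D)"
    using 1 2 by (simp add: algebra_simps)
  finally show ?case .
qed simp

text \<open>The initial state \<open>v\<close> and the acceptance functional \<open>e\<close> are
  matrices of the same kind, so that they can be exchanged to treat the reversed language.\<close>

definition projection_recognizes ::
  "nat \<Rightarrow> ('a \<Rightarrow> cmat \<Rightarrow> cmat) \<Rightarrow> cmat \<Rightarrow> cmat \<Rightarrow> real \<Rightarrow> real \<Rightarrow> 'a list set \<Rightarrow> bool" where
  "projection_recognizes m T v e cp \<delta> L \<longleftrightarrow> (\<forall>c. hs_projection m (T c)) \<and> 0 < \<delta> \<and>
     (\<forall>x. x \<in> L \<longleftrightarrow> cp < Re (hs_inner m (op_run T v x) e)) \<and>
     (\<forall>x. \<delta> \<le> \<bar>Re (hs_inner m (op_run T v x) e) - cp\<bar>)"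

lemma projection_recognizes_rev:
  assumes "projection_recognizes m T v e cp \<delta> L"
  shows "projection_recognizes m T e v cp \<delta> (rev ` L)"
proof -
  have "Re (hs_inner m (op_run T e x) v) = Re (hs_inner m (op_run T v (rev x)) e)" for x
    using assms by (subst hs_inner_op_run_rev) (auto simp: projection_recognizes_def hs_inner_cnj[of m e])
  moreover have "x \<in> rev ` L \<longleftrightarrow> rev x \<in> L" for x
    by (metis (no_types, lifting) image_iff rev_rev_ident)
  ultimately show ?thesis
    using assms by (simp add: projection_recognizes_def)
qed

text \<open>Values on opposite sides of the cut-point are at least \<open>2 * \<delta>\<close>
  apart.\<close>

lemma projection_recognizes_close:
  assumes "projection_recognizes m T v e cp \<delta> L"
    and "cmod (hs_inner m (op_run T v x) e - hs_inner m (op_run T v y) e) \<le> \<delta>"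
  shows "x \<in> L \<longleftrightarrow> y \<in> L"
proof -
  have "\<bar>Re (hs_inner m (op_run T v x) e) - Re (hs_inner m (op_run T v y) e)\<bar> \<le> \<delta>"
    using order_trans[OF abs_Re_le_cmod assms(2)] by simp
  moreover have "\<delta> \<le> \<bar>Re (hs_inner m (op_run T v x) e) - cp\<bar>" "\<delta> \<le> \<bar>Re (hs_inner m (op_run T v y) e) - cp\<bar>"
    "0 < \<delta>"
    using assms(1) by (simp_all add: projection_recognizes_def)
  ultimately have "cp < Re (hs_inner m (op_run T v x) e) \<longleftrightarrow> cp < Re (hs_inner m (op_run T v y) e)"
    by linarith
  with assms(1) show ?thesis
    by (simp add: projection_recognizes_def)
qed

text \<open>Along \<open>w x (s t)\<^sup>n\<close> the norm of the state decreases, so some factor \<open>s t\<close> costs almost no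
  norm; there the projections of \<open>s\<close> barely move the state.\<close>

lemma projection_recognizes_R_trivial:
  assumes rec: "projection_recognizes m T v e cp \<delta> L"
    and st: "syn_morph L (x @ s @ t) = syn_morph L x"
  shows "syn_morph L (x @ s) = syn_morph L x"
proof -
  have T: "\<And>c. hs_projection m (T c)" and "0 < \<delta>"
    using rec by (auto simp: projection_recognizes_def)
  define pow where "pow n = concat (replicate n (s @ t))" for n
  have pow_Suc: "pow (Suc n) = pow n @ s @ t" for n
    unfolding pow_def by (induction n) auto
  have pow: "syn_morph L (x @ pow n) = syn_morph L x" for n
  proof (induction n)
    case (Suc n)
    have "syn_morph L ((x @ pow n) @ s @ t) = syn_morph L (x @ s @ t)"
      by (intro syn_morph_append_cong Suc refl)
    with st show ?case by (simp add: pow_Suc)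
  qed (simp add: pow_def)
  have "w @ (x @ s) @ z \<in> L \<longleftrightarrow> w @ x @ z \<in> L" for w z
  proof -
    \<comment> \<open>The summand 1 keeps \<open>K\<close> positive. The threshold
      \<open>\<eta>\<close> below is chosen so that the displacement bound
      \<open>length s * entry_bound m e * sqrt \<eta>\<close> is at most
      \<open>\<delta>\<close>.\<close>
    define K where "K = length s * entry_bound m e + 1"
    have K: "0 < K"
      using entry_bound_nonneg[of m e] by (simp add: K_def add_nonneg_pos)
    define \<eta> where "\<eta> = (\<delta> / K)\<^sup>2"
    have "0 < \<eta>"
      using K \<open>0 < \<delta>\<close> by (simp add: \<eta>_def)
    define E where "E n = hs_normsq m (op_run T v (w @ x @ pow n))" for n
    have "\<exists>n. E n - E (Suc n) < \<eta>"
    proof (rule ccontr)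
      assume "\<not> ?thesis"
      then have drop: "\<eta> \<le> E n - E (Suc n)" for n
        by (simp add: not_less)
      have "n * \<eta> \<le> E 0 - E n" for n :: nat
      proof (induction n)
        case (Suc n)
        with drop[of n] show ?case by (simp add: algebra_simps)
      qed simp
      moreover have "E n \<ge> 0" for n
        by (simp add: E_def hs_normsq_nonneg)
      ultimately have "n * \<eta> \<le> E 0" for n :: nat
        by (smt (verit, best))
      moreover obtain n :: nat where "E 0 < n * \<eta>"
        using reals_Archimedean3[OF \<open>0 < \<eta>\<close>] by blast
      ultimately show False
        by (simp add: leD)
    qed
    then obtain n where n: "E n - E (Suc n) < \<eta>" by blast
    define X where "X = op_run T v (w @ x @ pow n)"
    have "hs_normsq m (op_run T (op_run T X s) t) \<le> hs_normsq m (op_run T X s)"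
      by (rule hs_normsq_op_run_le[OF T])
    with n have small: "hs_normsq m X - hs_normsq m (op_run T X s) \<le> \<eta>"
      by (simp add: E_def X_def pow_Suc)
    have "cmod (hs_inner m (op_run T X z) e - hs_inner m (op_run T (op_run T X s) z) e) \<le>
        length s * (entry_bound m e * sqrt (hs_normsq m X - hs_normsq m (op_run T X s)))"
      by (rule hs_inner_op_run_energy[OF T])
    also have "\<dots> \<le> length s * (entry_bound m e * sqrt \<eta>)"
      using small by (intro mult_left_mono entry_bound_nonneg) auto
    also have "\<dots> = length s * entry_bound m e * (\<delta> / K)"
      using K \<open>0 < \<delta>\<close> by (simp add: \<eta>_def)
    also have "\<dots> \<le> K * (\<delta> / K)"
      using K \<open>0 < \<delta>\<close> by (intro mult_right_mono) (auto simp: K_def)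
    also have "\<dots> = \<delta>"
      using K by simp
    finally have "w @ (x @ pow n) @ z \<in> L \<longleftrightarrow> w @ ((x @ pow n) @ s) @ z \<in> L"
      by (intro projection_recognizes_close[OF rec]) (simp add: X_def)
    \<comment> \<open>\<open>x @ pow n\<close> is equivalent to \<open>x\<close>, so the comparison
      made far along the iteration transfers back to \<open>x\<close>.\<close>
    moreover have "w @ (x @ pow n) @ z \<in> L \<longleftrightarrow> w @ x @ z \<in> L"
      using pow[of n] unfolding syn_morph_eq_iff by blast
    moreover have "w @ ((x @ pow n) @ s) @ z \<in> L \<longleftrightarrow> w @ (x @ s) @ z \<in> L"
      using syn_morph_append_cong[OF pow[of n] refl, of s] unfolding syn_morph_eq_iff by blast
    ultimately show ?thesis by blast
  qed
  then show ?thesis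
    unfolding syn_morph_eq_iff by blast
qed

lemma syn_morph_rev: "syn_morph (rev ` L) (rev u) = syn_morph (rev ` L) (rev v) \<longleftrightarrow> syn_morph L u = syn_morph L v"
proof -
  have mem: "x \<in> rev ` L \<longleftrightarrow> rev x \<in> L" for x
    by (metis (no_types, lifting) image_iff rev_rev_ident)
  have "(\<forall>x y. rev y @ u @ rev x \<in> L \<longleftrightarrow> rev y @ v @ rev x \<in> L) \<longleftrightarrow>
      (\<forall>x y. x @ u @ y \<in> L \<longleftrightarrow> x @ v @ y \<in> L)"
    by (metis rev_rev_ident)
  then show ?thesis
    unfolding syn_morph_eq_iff mem by simp
qed

text \<open>The reversed language is recognized by the same projections, and its R-triviality is the
  L-triviality of \<open>L\<close>.\<close>

lemma projection_recognizes_L_trivial: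
  assumes rec: "projection_recognizes m T v e cp \<delta> L"
    and st: "syn_morph L (t @ s @ x) = syn_morph L x"
  shows "syn_morph L (s @ x) = syn_morph L x"
proof -
  have "syn_morph (rev ` L) (rev x @ rev s @ rev t) = syn_morph (rev ` L) (rev x)"
    using st syn_morph_rev[of L "t @ s @ x" x] by simp
  from projection_recognizes_R_trivial[OF projection_recognizes_rev[OF rec] this]
  show ?thesis
    using syn_morph_rev[of L "s @ x" x] by simp
qed

text \<open>One direction of Myhill-Nerode, with the derivatives as states. They are numbered by
  \<open>h\<close> because \<open>regular\<close> asks for natural numbers.\<close>

lemma regular_if_finite_derivatives:
  assumes "finite (range (\<lambda>w. {z. w @ z \<in> L}))"
  shows "regular L"
proof -
  define D where "D w = {z. w @ z \<in> L}" for w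
  obtain h :: "_ \<Rightarrow> nat" where "bij_betw h (range D) {0..<card (range D)}"
    using ex_bij_betw_finite_nat assms unfolding D_def by blast
  then have inj: "inj_on h (range D)"
    by (rule bij_betw_imp_inj_on)
  \<comment> \<open>Any representative will do: the derivative of \<open>w @ [a]\<close> depends
    only on that of \<open>w\<close>.\<close>
  define \<delta> where "\<delta> q a = h (D ((SOME w. h (D w) = q) @ [a]))" for q a
  have \<delta>: "\<delta> (h (D w)) a = h (D (w @ [a]))" for w a
  proof -
    have "h (D (SOME u. h (D u) = h (D w))) = h (D w)"
      by (rule someI[of "\<lambda>u. h (D u) = h (D w)" w]) simp
    then have "D (SOME u. h (D u) = h (D w)) = D w"
      using inj by (simp add: inj_on_eq_iff)
    then have "D ((SOME u. h (D u) = h (D w)) @ [a]) = D (w @ [a])"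
      by (auto simp: D_def set_eq_iff)
    then show ?thesis
      by (simp add: \<delta>_def)
  qed
  have run: "foldl \<delta> (h (D u)) w = h (D (u @ w))" for u w
    by (induction w arbitrary: u) (simp_all add: \<delta>)
  have "h (D w) \<in> h ` D ` L \<longleftrightarrow> w \<in> L" for w
  proof
    assume "h (D w) \<in> h ` D ` L"
    then obtain u where "u \<in> L" "h (D w) = h (D u)" by blast
    then have "D w = D u"
      using inj by (simp add: inj_on_eq_iff)
    moreover have "[] \<in> D u"
      using \<open>u \<in> L\<close> by (simp add: D_def)
    ultimately have "[] \<in> D w" by simp
    then show "w \<in> L"
      by (simp add: D_def)
  qed blast
  then have "L = {w. foldl \<delta> (h (D [])) w \<in> h ` D ` L}"
    using run[of "[]"] by simp
  moreover have "\<forall>q\<in>h ` range D. \<forall>a. \<delta> q a \<in> h ` range D"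
    by (auto simp: \<delta>)
  moreover have "finite (h ` range D)"
    using assms by (simp add: D_def)
  moreover have "h (D []) \<in> h ` range D" "h ` D ` L \<subseteq> h ` range D"
    by auto
  ultimately show ?thesis
    unfolding regular_def
    by (intro exI[of _ "h ` range D"] exI[of _ "h (D [])"] exI[of _ \<delta>] exI[of _ "h ` D ` L"] conjI)
qed

lemma floor_divide_eqD:
  fixes a b \<epsilon> :: real
  assumes "\<lfloor>a / \<epsilon>\<rfloor> = \<lfloor>b / \<epsilon>\<rfloor>" "0 < \<epsilon>"
  shows "\<bar>a - b\<bar> \<le> \<epsilon>"
proof -
  have "\<bar>a / \<epsilon> - b / \<epsilon>\<bar> \<le> 1"
    using assms(1) by linarith
  then have "\<bar>a - b\<bar> / \<epsilon> \<le> 1"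
    using assms(2) by (simp add: diff_divide_distrib[symmetric] abs_divide)
  then show ?thesis
    using assms(2) by simp
qed

text \<open>The states stay in a bounded set, and words with the same rounded state have the same
  derivative.\<close>

lemma projection_recognizes_regular:
  assumes rec: "projection_recognizes m T v e cp \<delta> L"
  shows "regular L"
proof (rule regular_if_finite_derivatives)
  have T: "\<And>c. hs_projection m (T c)" and "0 < \<delta>"
    using rec by (auto simp: projection_recognizes_def)
  \<comment> \<open>With rounding width \<open>\<epsilon>\<close>, equal codes mean that entries
    differ by at most \<open>2 * \<epsilon>\<close>, and states by at most
    \<open>2 * m * \<epsilon>\<close> in norm. \<open>K\<close> is chosen to turn this into an
    acceptance difference of at most \<open>\<delta>\<close>.\<close>
  define K where "K = 2 * real m * entry_bound m e + 1"
  have K: "0 < K"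
    using entry_bound_nonneg[of m e] by (simp add: K_def add_nonneg_pos)
  define \<epsilon> where "\<epsilon> = \<delta> / K"
  have "0 < \<epsilon>"
    using K \<open>0 < \<delta>\<close> by (simp add: \<epsilon>_def)
  define B where "B = sqrt (hs_normsq m v)"
  \<comment> \<open>The restriction to the index square makes \<open>code w\<close> an element of a
    finite function space.\<close>
  define code where "code w = (\<lambda>(i, j)\<in>{..<m} \<times> {..<m}.
    (\<lfloor>Re (op_run T v w i j) / \<epsilon>\<rfloor>, \<lfloor>Im (op_run T v w i j) / \<epsilon>\<rfloor>))" for w
  let ?R = "{\<lfloor>- B / \<epsilon>\<rfloor>..\<lfloor>B / \<epsilon>\<rfloor>}"
  have bound: "cmod (op_run T v w i j) \<le> B" if "i < m" "j < m" for w i j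
    unfolding B_def
    using cmod_entry_le_hs_norm[OF that, of "op_run T v w"]
      real_sqrt_le_mono[OF hs_normsq_op_run_le[where T = T and m = m, OF T, where v = v and x = w]] by linarith
  have floor: "\<lfloor>a / \<epsilon>\<rfloor> \<in> ?R" if "\<bar>a\<bar> \<le> B" for a
    unfolding atLeastAtMost_iff using that \<open>0 < \<epsilon>\<close>
    by (intro conjI floor_mono divide_right_mono) auto
  have "range code \<subseteq> ({..<m} \<times> {..<m}) \<rightarrow>\<^sub>E (?R \<times> ?R)"
  proof (intro image_subsetI PiE_I)
    fix w p assume "p \<in> {..<m} \<times> {..<m}"
    then obtain i j where p: "p = (i, j)" "i < m" "j < m" by auto
    then show "code w p \<in> ?R \<times> ?R"
      using floor[OF order_trans[OF abs_Re_le_cmod bound], of i j w]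
        floor[OF order_trans[OF abs_Im_le_cmod bound], of i j w] by (simp add: code_def)
  qed (auto simp: code_def)
  moreover have "finite (({..<m} \<times> {..<m}) \<rightarrow>\<^sub>E (?R \<times> ?R))"
    by (intro finite_PiE) auto
  ultimately have "finite (range code)"
    by (rule finite_subset)
  then show "finite (range (\<lambda>w. {z. w @ z \<in> L}))"
  proof (rule finite_range_factor)
    fix w u assume eq: "code w = code u"
    let ?X = "op_run T v w" and ?Y = "op_run T v u"
    have close: "cmod (?X i j - ?Y i j) \<le> 2 * \<epsilon>" if "i < m" "j < m" for i j
    proof -
      have "code w (i, j) = code u (i, j)"
        using eq by simp
      then have "\<bar>Re (?X i j) - Re (?Y i j)\<bar> \<le> \<epsilon>" "\<bar>Im (?X i j) - Im (?Y i j)\<bar> \<le> \<epsilon>"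
        using that \<open>0 < \<epsilon>\<close> by (auto simp: code_def intro!: floor_divide_eqD)
      then show ?thesis
        using cmod_le[of "?X i j - ?Y i j"] by simp
    qed
    have "hs_normsq m (\<lambda>i j. ?X i j - ?Y i j) \<le> (\<Sum>i<m. \<Sum>j<m. (2 * \<epsilon>)\<^sup>2)"
      unfolding hs_normsq_def by (intro sum_mono power_mono close) auto
    also have "\<dots> = (2 * m * \<epsilon>)\<^sup>2"
      by (simp add: power2_eq_square)
    finally have normsq: "sqrt (hs_normsq m (\<lambda>i j. ?X i j - ?Y i j)) \<le> 2 * m * \<epsilon>"
      using \<open>0 < \<epsilon>\<close> by (simp add: real_le_lsqrt)
    have "w @ z \<in> L \<longleftrightarrow> u @ z \<in> L" for z
    proof (rule projection_recognizes_close[OF rec])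
      have "cmod (hs_inner m (op_run T v (w @ z)) e - hs_inner m (op_run T v (u @ z)) e) \<le>
          entry_bound m e * sqrt (hs_normsq m (\<lambda>i j. ?X i j - ?Y i j))"
        using hs_inner_op_run_dist[where T = T and m = m, OF T, where X = ?X and Y = ?Y and z = z and e = e] by simp
      also have "\<dots> \<le> entry_bound m e * (2 * m * \<epsilon>)"
        by (intro mult_left_mono normsq entry_bound_nonneg)
      also have "\<dots> = 2 * m * entry_bound m e * \<epsilon>"
        by simp
      also have "\<dots> \<le> K * \<epsilon>"
        using \<open>0 < \<epsilon>\<close> by (intro mult_right_mono) (auto simp: K_def)
      also have "\<dots> = \<delta>"
        using K by (simp add: \<epsilon>_def)
      finally show "cmod (hs_inner m (op_run T v (w @ z)) e - hs_inner m (op_run T v (u @ z)) e) \<le> \<delta>" .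
    qed
    then show "{z. w @ z \<in> L} = {z. u @ z \<in> L}" by blast
  qed
qed

text \<open>From \<open>u = p v q\<close> and \<open>v = p' u q'\<close> follows
  \<open>u = (p p') u (q' q)\<close>. By finiteness some power of \<open>p p'\<close> fixes
  \<open>u\<close> on the left and some power of \<open>q' q\<close> fixes it on the right. Then L-
  and R-triviality give \<open>p' u = u = u q'\<close>, hence \<open>v = u\<close>.\<close>

lemma finite_R_L_trivial_imp_J_trivial:
  assumes fin: "finite (range (syn_morph L))"
    and R: "\<And>x s t. syn_morph L (x @ s @ t) = syn_morph L x \<Longrightarrow> syn_morph L (x @ s) = syn_morph L x"
    and L: "\<And>x s t. syn_morph L (t @ s @ x) = syn_morph L x \<Longrightarrow> syn_morph L (s @ x) = syn_morph L x"
  shows "J_trivial_syn L"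
  unfolding J_trivial_syn_iff
proof (intro allI impI)
  let ?\<phi> = "syn_morph L"
  note cong = syn_morph_append_cong[of L]
  define pow where "pow n a = concat (replicate n a)" for n and a :: "'a list"
  have pow_add: "pow (i + j) a = pow i a @ pow j a" for i j a
    by (simp add: pow_def replicate_add)
  have pow_Suc: "pow (Suc n) a = a @ pow n a" for n a
    by (simp add: pow_def)
  have pow_Suc2: "pow (Suc n) a = pow n a @ a" for n a
    using pow_add[of n 1 a] by (simp add: pow_def)
  \<comment> \<open>Pigeonhole: the classes of the powers of \<open>a\<close> repeat with some
    period \<open>j\<close> from an exponent \<open>i\<close> on.\<close>
  have rep: "\<exists>i j. 0 < j \<and> ?\<phi> (pow (j + i) a) = ?\<phi> (pow i a)" for a
  proof -
    have "\<not> inj (\<lambda>n. ?\<phi> (pow n a))"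
      using fin finite_subset[of "range (\<lambda>n. ?\<phi> (pow n a))" "range ?\<phi>"] finite_imageD[of "\<lambda>n. ?\<phi> (pow n a)" UNIV]
      by auto
    then obtain i k where "i < k" "?\<phi> (pow k a) = ?\<phi> (pow i a)"
      unfolding inj_def by (metis nat_neq_iff)
    then have "0 < k - i \<and> ?\<phi> (pow (k - i + i) a) = ?\<phi> (pow i a)"
      by simp
    then show ?thesis by blast
  qed
  \<comment> \<open>Iteration gives \<open>a^i x b^i = x\<close> for the exponent \<open>i\<close>
    at which the powers start to repeat; there a factor \<open>a^j\<close> is absorbed. The right
    side is analogous.\<close>
  have stable: "\<exists>j>0. ?\<phi> (pow j a @ x) = ?\<phi> x" "\<exists>j>0. ?\<phi> (x @ pow j b) = ?\<phi> x"
    if axb: "?\<phi> (a @ x @ b) = ?\<phi> x" for a x b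
  proof -
    have pw: "?\<phi> (pow n a @ x @ pow n b) = ?\<phi> x" for n
    proof (induction n)
      case (Suc n)
      have "?\<phi> (pow n a @ (a @ x @ b) @ pow n b) = ?\<phi> (pow n a @ x @ pow n b)"
        by (intro cong axb refl)
      with Suc show ?case by (simp add: pow_Suc2[of n a] pow_Suc[of n b])
    qed (simp add: pow_def)
    obtain i j where j: "0 < j" "?\<phi> (pow (j + i) a) = ?\<phi> (pow i a)"
      using rep by blast
    have "?\<phi> (pow j a @ x) = ?\<phi> (pow j a @ pow i a @ x @ pow i b)"
      by (intro cong refl pw[symmetric])
    also have "\<dots> = ?\<phi> (pow (j + i) a @ x @ pow i b)"
      by (simp add: pow_add)
    also have "\<dots> = ?\<phi> (pow i a @ x @ pow i b)"
      by (intro cong refl j)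
    finally show "\<exists>j>0. ?\<phi> (pow j a @ x) = ?\<phi> x"
      using pw j(1) by auto
    obtain i j where j: "0 < j" "?\<phi> (pow (j + i) b) = ?\<phi> (pow i b)"
      using rep by blast
    have "?\<phi> (x @ pow j b) = ?\<phi> ((pow i a @ x @ pow i b) @ pow j b)"
      by (intro cong refl pw[symmetric])
    also have "\<dots> = ?\<phi> ((pow i a @ x) @ pow (j + i) b)"
      by (simp add: pow_add[symmetric] add.commute)
    also have "\<dots> = ?\<phi> ((pow i a @ x) @ pow i b)"
      by (intro cong refl j)
    finally show "\<exists>j>0. ?\<phi> (x @ pow j b) = ?\<phi> x"
      using pw j(1) by auto
  qed
  fix u v
  assume ideals: "{?\<phi> (p @ u @ q) | p q. True} = {?\<phi> (p @ v @ q) | p q. True}"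
  have "?\<phi> ([] @ u @ []) \<in> {?\<phi> (p @ v @ q) | p q. True}"
    unfolding ideals[symmetric] by blast
  then obtain p q where u: "?\<phi> u = ?\<phi> (p @ v @ q)" by auto
  have "?\<phi> ([] @ v @ []) \<in> {?\<phi> (p @ u @ q) | p q. True}"
    unfolding ideals by blast
  then obtain p' q' where v: "?\<phi> v = ?\<phi> (p' @ u @ q')" by auto
  have "?\<phi> (p @ (p' @ u @ q') @ q) = ?\<phi> (p @ v @ q)"
    by (intro cong refl v[symmetric])
  then have loop: "?\<phi> ((p @ p') @ u @ (q' @ q)) = ?\<phi> u"
    using u by simp
  obtain j where "?\<phi> (pow (Suc j) (p @ p') @ u) = ?\<phi> u"
    using stable(1)[OF loop] by (metis gr0_implies_Suc)
  \<comment> \<open>The last factor \<open>p'\<close> of the power stands next to \<open>u\<close>;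
    everything before it plays the part of \<open>t\<close> in L-triviality.\<close>
  then have pu: "?\<phi> (p' @ u) = ?\<phi> u"
    using L[of "pow j (p @ p') @ p" p' u] by (simp add: pow_Suc2)
  obtain j where "?\<phi> (u @ pow (Suc j) (q' @ q)) = ?\<phi> u"
    using stable(2)[OF loop] by (metis gr0_implies_Suc)
  then have uq: "?\<phi> (u @ q') = ?\<phi> u"
    using R[of u q' "q @ pow j (q' @ q)"] by (simp add: pow_Suc)
  have "?\<phi> v = ?\<phi> (p' @ u)"
    unfolding v by (intro cong refl uq)
  with pu show "?\<phi> u = ?\<phi> v" by simp
qed

section \<open>Measure-only automata recognize languages of the variety\<close>

lemma mmult_assoc: "mmult m (mmult m A B) C = mmult m A (mmult m B C)"
proof (intro ext)
  fix i j
  have "mmult m (mmult m A B) C i j = (\<Sum>l<m. \<Sum>k<m. A i k * B k l * C l j)"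
    by (simp add: mmult_def sum_distrib_right)
  also have "\<dots> = (\<Sum>k<m. \<Sum>l<m. A i k * B k l * C l j)"
    by (rule sum.swap)
  also have "\<dots> = mmult m A (mmult m B C) i j"
    by (simp add: mmult_def sum_distrib_left mult.assoc)
  finally show "mmult m (mmult m A B) C i j = mmult m A (mmult m B C) i j" .
qed

text \<open>Projector identities hold only for indices below \<open>m\<close>, so they are applied
  to entries rather than to whole functions.\<close>

lemma mmult_cong:
  assumes "\<And>k. k < m \<Longrightarrow> A i k = A' i k" "\<And>k. k < m \<Longrightarrow> B k j = B' k j"
  shows "mmult m A B i j = mmult m A' B' i j"
  unfolding mmult_def by (rule sum.cong) (simp_all add: assms)

lemma mmult_sum_left: "mmult m (\<lambda>i j. \<Sum>r\<in>R. A r i j) B = (\<lambda>i j. \<Sum>r\<in>R. mmult m (A r) B i j)"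
  unfolding mmult_def by (intro ext) (simp add: sum_distrib_right sum.swap[of _ R])

lemma mmult_sum_right: "mmult m B (\<lambda>i j. \<Sum>r\<in>R. A r i j) = (\<lambda>i j. \<Sum>r\<in>R. mmult m B (A r) i j)"
  unfolding mmult_def by (intro ext) (simp add: sum_distrib_left sum.swap[of _ R])

lemma mmult_diff:
  "mmult m (\<lambda>i j. A i j - B i j) C = (\<lambda>i j. mmult m A C i j - mmult m B C i j)"
  "mmult m C (\<lambda>i j. A i j - B i j) = (\<lambda>i j. mmult m C A i j - mmult m C B i j)"
  unfolding mmult_def by (simp_all add: left_diff_distrib right_diff_distrib sum_subtractf)

lemma hs_inner_sum_left: "hs_inner m (\<lambda>i j. \<Sum>r\<in>R. X r i j) Y = (\<Sum>r\<in>R. hs_inner m (X r) Y)"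
  unfolding hs_inner_def by (simp add: sum_distrib_right sum.swap[of _ R])

lemma hs_inner_sum_right: "hs_inner m Y (\<lambda>i j. \<Sum>r\<in>R. X r i j) = (\<Sum>r\<in>R. hs_inner m Y (X r))"
  unfolding hs_inner_def by (simp add: sum_distrib_left sum.swap[of _ R])

lemma hs_inner_mmult_left:
  assumes "hermitian m P"
  shows "hs_inner m (mmult m P X) Y = hs_inner m X (mmult m P Y)"
proof -
  have "hs_inner m (mmult m P X) Y = (\<Sum>i<m. \<Sum>j<m. \<Sum>k<m. P i k * X k j * cnj (Y i j))"
    by (simp add: hs_inner_def mmult_def sum_distrib_right)
  also have "\<dots> = (\<Sum>i<m. \<Sum>k<m. \<Sum>j<m. P i k * X k j * cnj (Y i j))"
    by (intro sum.cong refl sum.swap)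
  also have "\<dots> = (\<Sum>k<m. \<Sum>i<m. \<Sum>j<m. P i k * X k j * cnj (Y i j))"
    by (rule sum.swap)
  also have "\<dots> = (\<Sum>k<m. \<Sum>j<m. \<Sum>i<m. P i k * X k j * cnj (Y i j))"
    by (intro sum.cong refl sum.swap)
  also have "\<dots> = (\<Sum>k<m. \<Sum>j<m. \<Sum>i<m. X k j * (cnj (P k i) * cnj (Y i j)))"
    using assms unfolding hermitian_def by (intro sum.cong refl) (metis lessThan_iff mult.assoc mult.left_commute)
  also have "\<dots> = hs_inner m X (mmult m P Y)"
    by (simp add: hs_inner_def mmult_def sum_distrib_left)
  finally show ?thesis .
qed

lemma hs_inner_mmult_right:
  assumes "hermitian m P"
  shows "hs_inner m (mmult m X P) Y = hs_inner m X (mmult m Y P)"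
proof -
  have "hs_inner m (mmult m X P) Y = (\<Sum>i<m. \<Sum>j<m. \<Sum>k<m. X i k * P k j * cnj (Y i j))"
    by (simp add: hs_inner_def mmult_def sum_distrib_right)
  also have "\<dots> = (\<Sum>i<m. \<Sum>k<m. \<Sum>j<m. X i k * P k j * cnj (Y i j))"
    by (intro sum.cong refl sum.swap)
  also have "\<dots> = (\<Sum>i<m. \<Sum>k<m. \<Sum>j<m. X i k * (cnj (Y i j) * cnj (P j k)))"
    using assms unfolding hermitian_def by (intro sum.cong refl) (metis lessThan_iff mult.assoc mult.commute)
  also have "\<dots> = hs_inner m X (mmult m Y P)"
    by (simp add: hs_inner_def mmult_def sum_distrib_left)
  finally show ?thesis .
qed

lemma is_mon_qfaD:
  assumes "is_mon_qfa A"
  shows "finite (eigs A c)"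
    and "r \<in> eigs A c \<Longrightarrow> hermitian (dim A) (proj A c r)"
    and "r \<in> eigs A c \<Longrightarrow> i < dim A \<Longrightarrow> j < dim A \<Longrightarrow>
      mmult (dim A) (proj A c r) (proj A c r) i j = proj A c r i j"
    and "r \<in> eigs A c \<Longrightarrow> s \<in> eigs A c \<Longrightarrow> r \<noteq> s \<Longrightarrow> i < dim A \<Longrightarrow> j < dim A \<Longrightarrow>
      mmult (dim A) (proj A c r) (proj A c s) i j = 0"
    and "acc A \<subseteq> eigs A None"
  using assms by (auto simp: is_mon_qfa_def Let_def orth_projector_def meq_def mzero_def)

text \<open>\<open>P_r P_s X P_s P_r\<close> vanishes for \<open>r \<noteq> s\<close> and is
  \<open>P_r X P_r\<close> otherwise, so the double sum reduces to its diagonal.\<close>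

lemma qstep_qstep:
  assumes A: "is_mon_qfa A" and ij: "i < dim A" "j < dim A"
  shows "qstep A (qstep A X c) c i j = qstep A X c i j"
proof -
  let ?m = "dim A" and ?E = "eigs A c" and ?P = "proj A c"
  note D = is_mon_qfaD[OF A]
  have PXP: "mmult ?m (mmult ?m (?P r) (mmult ?m (mmult ?m (?P s) X) (?P s))) (?P r) i j =
      (if r = s then mmult ?m (mmult ?m (?P r) X) (?P r) i j else 0)" if "r \<in> ?E" "s \<in> ?E" for r s
  proof -
    have "mmult ?m (mmult ?m (?P r) (mmult ?m (mmult ?m (?P s) X) (?P s))) (?P r) i j =
        mmult ?m (mmult ?m (?P r) (?P s)) (mmult ?m X (mmult ?m (?P s) (?P r))) i j"
      by (simp add: mmult_assoc)
    also have "\<dots> = (if r = s then mmult ?m (mmult ?m (?P r) X) (?P r) i j else 0)"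
    proof (cases "r = s")
      case True
      have "mmult ?m (mmult ?m (?P r) (?P s)) (mmult ?m X (mmult ?m (?P s) (?P r))) i j =
          mmult ?m (?P r) (mmult ?m X (?P r)) i j"
        using that ij True by (intro mmult_cong) (auto simp: D(3))
      with True show ?thesis by (simp add: mmult_assoc)
    next
      case False
      have "mmult ?m (mmult ?m (?P r) (?P s)) (mmult ?m X (mmult ?m (?P s) (?P r))) i j = (\<Sum>k<?m. 0)"
        unfolding mmult_def[of _ "mmult ?m (?P r) (?P s)"] using that ij False
        by (intro sum.cong) (auto simp: D(4))
      with False show ?thesis by simp
    qed
    finally show ?thesis .
  qed
  have "qstep A (qstep A X c) c i j =
      (\<Sum>r\<in>?E. \<Sum>s\<in>?E. mmult ?m (mmult ?m (?P r) (mmult ?m (mmult ?m (?P s) X) (?P s))) (?P r) i j)"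
    unfolding qstep_def by (simp add: mmult_sum_left mmult_sum_right)
  also have "\<dots> = (\<Sum>r\<in>?E. \<Sum>s\<in>?E. if r = s then mmult ?m (mmult ?m (?P r) X) (?P r) i j else 0)"
    by (intro sum.cong refl PXP)
  also have "\<dots> = qstep A X c i j"
    using D(1) by (simp add: qstep_def)
  finally show ?thesis .
qed

text \<open>Mapping \<open>X\<close> to \<open>P X P\<close> is self-adjoint for Hermitian
  \<open>P\<close>, and so is the sum over the eigenvalues.\<close>

lemma hs_projection_qstep:
  assumes A: "is_mon_qfa A"
  shows "hs_projection (dim A) (\<lambda>X. qstep A X c)"
  unfolding hs_projection_def
proof (intro conjI allI)
  let ?m = "dim A"
  fix X Y
  show "qstep A (\<lambda>i j. X i j - Y i j) c = (\<lambda>i j. qstep A X c i j - qstep A Y c i j)"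
    unfolding qstep_def by (simp add: mmult_diff sum_subtractf)
  show "hs_inner ?m (qstep A X c) Y = hs_inner ?m X (qstep A Y c)"
    unfolding qstep_def hs_inner_sum_left hs_inner_sum_right
    by (intro sum.cong refl)
      (simp add: hs_inner_mmult_left hs_inner_mmult_right mmult_assoc is_mon_qfaD(2)[OF A])
  show "hs_inner ?m (qstep A (qstep A X c) c) Y = hs_inner ?m (qstep A X c) Y"
    unfolding hs_inner_def by (intro sum.cong refl) (simp add: qstep_qstep[OF A])
qed

text \<open>For Hermitian \<open>P\<close> the trace of \<open>P X\<close> is the inner product of
  \<open>X\<close> with \<open>P\<close>. The final measurement thus becomes a single functional, as
  \<open>projection_recognizes\<close> requires.\<close>

lemma acc_prob_hs_inner:
  assumes A: "is_mon_qfa A"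
  shows "acc_prob A x = Re (hs_inner (dim A) (op_run (\<lambda>c X. qstep A X (Some c)) (rho0 A) x)
    (\<lambda>i j. \<Sum>r\<in>acc A. proj A None r i j))"
proof -
  let ?m = "dim A"
  have run: "rho_final A x = op_run (\<lambda>c X. qstep A X (Some c)) (rho0 A) x"
    by (simp add: rho_final_def op_run_def foldl_map)
  have "mtrace ?m (mmult ?m (proj A None r) X) = hs_inner ?m X (proj A None r)" if "r \<in> acc A" for r X
  proof -
    have "hermitian ?m (proj A None r)"
      using is_mon_qfaD(2,5)[OF A] that by blast
    then have "hs_inner ?m X (proj A None r) = (\<Sum>i<?m. \<Sum>j<?m. proj A None r j i * X i j)"
      unfolding hs_inner_def hermitian_def by (intro sum.cong refl) (metis lessThan_iff mult.commute)
    also have "\<dots> = mtrace ?m (mmult ?m (proj A None r) X)"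
      unfolding mtrace_def mmult_def by (rule sum.swap)
    finally show ?thesis ..
  qed
  then show ?thesis
    by (simp add: acc_prob_def hs_inner_sum_right run)
qed

theorem LMO_subset_VJbar: "LMO \<subseteq> VJbar"
proof
  fix L :: "'a list set"
  assume "L \<in> LMO"
  then obtain A :: "'a mon_qfa" and cp \<delta> where A: "is_mon_qfa A" and "0 < \<delta>"
    and "\<And>x. x \<in> L \<longleftrightarrow> cp < acc_prob A x" "\<And>x. \<delta> \<le> \<bar>acc_prob A x - cp\<bar>"
    unfolding LMO_def recognizes_isolated_def by blast
  then have rec: "projection_recognizes (dim A) (\<lambda>c X. qstep A X (Some c)) (rho0 A)
      (\<lambda>i j. \<Sum>r\<in>acc A. proj A None r i j) cp \<delta> L"
    by (simp add: projection_recognizes_def acc_prob_hs_inner[OF A] hs_projection_qstep[OF A])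
  have reg: "regular L"
    by (rule projection_recognizes_regular[OF rec])
  have "J_trivial_syn L"
    by (rule finite_R_L_trivial_imp_J_trivial[OF regular_finite_syn_monoid[OF reg]])
      (fact projection_recognizes_R_trivial[OF rec] projection_recognizes_L_trivial[OF rec])+
  moreover have "syn_morph L [a, a] = syn_morph L [a]" for a
  proof -
    have "hs_inner (dim A) (qstep A (qstep A X (Some a)) (Some a)) Y = hs_inner (dim A) (qstep A X (Some a)) Y" for X Y
      using hs_projection_qstep[OF A, of "Some a"] unfolding hs_projection_def by blast
    \<comment> \<open>\<open>y\<close> is moved to the second argument, which leaves the doubled
      letter outermost in the first one, where idempotency applies.\<close>
    then have "x @ [a, a] @ y \<in> L \<longleftrightarrow> x @ [a] @ y \<in> L" for x y
      using \<open>0 < \<delta>\<close> by (intro projection_recognizes_close[OF rec])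
        (simp add: hs_inner_op_run_rev[where T = "\<lambda>c X. qstep A X (Some c)", OF hs_projection_qstep[OF A]])
    then show ?thesis
      unfolding syn_morph_eq_iff by blast
  qed
  ultimately show "L \<in> VJbar"
    using reg by (simp add: VJbar_def syn_mult_syn_morph)
qed

section \<open>Block-averaging automata\<close>

definition block :: "'s set \<Rightarrow> ('a \<Rightarrow> 's \<Rightarrow> nat) \<Rightarrow> 'a \<Rightarrow> 's \<Rightarrow> 's set" where
  "block S cl c s = {t \<in> S. cl c t = cl c s}"

definition block_step :: "'s set \<Rightarrow> ('a \<Rightarrow> 's \<Rightarrow> nat) \<Rightarrow> ('s \<Rightarrow> real) \<Rightarrow> 'a \<Rightarrow> 's \<Rightarrow> real" where
  "block_step S cl \<rho> c s = (\<Sum>t\<in>block S cl c s. \<rho> t) / card (block S cl c s)"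

definition block_run :: "'s set \<Rightarrow> ('a \<Rightarrow> 's \<Rightarrow> nat) \<Rightarrow> 's \<Rightarrow> 'a list \<Rightarrow> 's \<Rightarrow> real" where
  "block_run S cl s0 x = foldl (block_step S cl) (\<lambda>s. if s = s0 then 1 else 0) x"

lemma block_run_Nil: "block_run S cl s0 [] = (\<lambda>s. if s = s0 then 1 else 0)"
  by (simp add: block_run_def)

lemma block_run_snoc: "block_run S cl s0 (x @ [c]) = block_step S cl (block_run S cl s0 x) c"
  by (simp add: block_run_def)

lemma block_run_nonneg: "0 \<le> block_run S cl s0 x s"
  by (induction x arbitrary: s rule: rev_induct)
    (auto simp: block_run_Nil block_run_snoc block_step_def intro!: sum_nonneg divide_nonneg_nonneg)

text \<open>After exchanging the sums, each state hands out its mass in equal shares to the states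
  of its block.\<close>

lemma sum_block_step:
  assumes "finite S"
  shows "(\<Sum>s\<in>S. block_step S cl \<rho> c s) = (\<Sum>s\<in>S. \<rho> s)"
proof -
  have "(\<Sum>s\<in>S. block_step S cl \<rho> c s) =
      (\<Sum>s\<in>S. \<Sum>t\<in>S. if cl c t = cl c s then \<rho> t / card (block S cl c s) else 0)"
    unfolding block_step_def sum_divide_distrib block_def
    by (rule sum.cong[OF refl]) (rule sum.inter_filter[OF assms])
  also have "\<dots> = (\<Sum>t\<in>S. \<Sum>s\<in>S. if cl c t = cl c s then \<rho> t / card (block S cl c s) else 0)"
    by (rule sum.swap)
  also have "\<dots> = (\<Sum>t\<in>S. \<rho> t)"
  proof (rule sum.cong[OF refl])
    fix t assume "t \<in> S"
    have "(\<Sum>s\<in>S. if cl c t = cl c s then \<rho> t / card (block S cl c s) else 0) =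
        (\<Sum>s\<in>block S cl c t. \<rho> t / card (block S cl c t))"
      unfolding block_def sum.inter_filter[OF assms] by (intro sum.cong refl) auto
    also have "\<dots> = \<rho> t"
    proof -
      have "card (block S cl c t) \<noteq> 0"
        using assms \<open>t \<in> S\<close> by (auto simp: block_def)
      then show ?thesis by simp
    qed
    finally show "(\<Sum>s\<in>S. if cl c t = cl c s then \<rho> t / card (block S cl c s) else 0) = \<rho> t" .
  qed
  finally show ?thesis .
qed

lemma sum_block_run:
  assumes "finite S" "s0 \<in> S"
  shows "(\<Sum>s\<in>S. block_run S cl s0 x s) = 1"
  by (induction x rule: rev_induct)
    (use assms in \<open>simp_all add: block_run_Nil block_run_snoc sum_block_step\<close>)

lemma block_run_accept_le_1:
  assumes "finite S" "s0 \<in> S" "F \<subseteq> S"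
  shows "(\<Sum>s\<in>F. block_run S cl s0 x s) \<le> 1"
proof -
  have "(\<Sum>s\<in>F. block_run S cl s0 x s) \<le> (\<Sum>s\<in>S. block_run S cl s0 x s)"
    by (intro sum_mono2 assms block_run_nonneg)
  then show ?thesis
    by (simp add: sum_block_run[OF assms(1,2)])
qed

text \<open>Used to replace an arbitrary finite state set by an initial segment of the naturals,
  which can index matrices.\<close>

lemma block_run_reindex:
  assumes "bij_betw h T S" "t0 \<in> T" "t \<in> T"
  shows "block_run T (\<lambda>c. cl c \<circ> h) t0 x t = block_run S cl (h t0) x (h t)"
  using assms(3)
proof (induction x arbitrary: t rule: rev_induct)
  case Nil
  then show ?case
    using assms(1,2) by (auto simp: block_run_Nil bij_betw_def inj_on_eq_iff)
next
  case (snoc c x)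
  define clh where "clh = (\<lambda>c. cl c \<circ> h)"
  have inj: "inj_on h (block T clh c t)"
    using assms(1) by (auto simp: bij_betw_def block_def intro: inj_on_subset)
  have img: "block S cl c (h t) = h ` block T clh c t"
    using assms(1) by (auto simp: bij_betw_def block_def clh_def)
  have "(\<Sum>u\<in>block T clh c t. block_run T clh t0 x u) =
      (\<Sum>u\<in>block T clh c t. block_run S cl (h t0) x (h u))"
    unfolding clh_def by (intro sum.cong refl snoc.IH) (simp add: block_def)
  then have "block_run T clh t0 (x @ [c]) t = block_run S cl (h t0) (x @ [c]) (h t)"
    by (simp add: block_run_snoc block_step_def img sum.reindex[OF inj] card_image[OF inj])
  then show ?case
    by (simp only: clh_def)
qed

text \<open>Arbitrarily small error is demanded because errors add up under intersection.\<close>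

definition block_approximable :: "'a list set \<Rightarrow> bool" where
  "block_approximable L \<longleftrightarrow> (\<forall>\<epsilon>>0. \<exists>(m::nat) cl s0 F. s0 < m \<and> F \<subseteq> {..<m} \<and>
     (\<forall>x. (x \<in> L \<longrightarrow> 1 - \<epsilon> \<le> (\<Sum>s\<in>F. block_run {..<m} cl s0 x s)) \<and>
          (x \<notin> L \<longrightarrow> (\<Sum>s\<in>F. block_run {..<m} cl s0 x s) \<le> \<epsilon>)))"

lemma block_approximableE:
  assumes "block_approximable L" "0 < \<epsilon>"
  obtains m :: nat and cl s0 F where "s0 < m" "F \<subseteq> {..<m}"
    "\<And>x. x \<in> L \<Longrightarrow> 1 - \<epsilon> \<le> (\<Sum>s\<in>F. block_run {..<m} cl s0 x s)"
    "\<And>x. x \<notin> L \<Longrightarrow> (\<Sum>s\<in>F. block_run {..<m} cl s0 x s) \<le> \<epsilon>"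
proof -
  obtain m :: nat and cl s0 F where "s0 < m \<and> F \<subseteq> {..<m} \<and>
     (\<forall>x. (x \<in> L \<longrightarrow> 1 - \<epsilon> \<le> (\<Sum>s\<in>F. block_run {..<m} cl s0 x s)) \<and>
          (x \<notin> L \<longrightarrow> (\<Sum>s\<in>F. block_run {..<m} cl s0 x s) \<le> \<epsilon>))"
    using assms(1)[unfolded block_approximable_def, THEN spec[of _ \<epsilon>], THEN mp, OF assms(2)]
    by (elim exE) (rule that)
  then show thesis
    by (intro that[of s0 m F cl]) simp_all
qed

lemma block_approximableI:
  assumes "\<And>\<epsilon>::real. 0 < \<epsilon> \<Longrightarrow> \<exists>(S::'s set) cl s0 F. finite S \<and> s0 \<in> S \<and> F \<subseteq> S \<and>
     (\<forall>x. (x \<in> L \<longrightarrow> 1 - \<epsilon> \<le> (\<Sum>s\<in>F. block_run S cl s0 x s)) \<and>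
          (x \<notin> L \<longrightarrow> (\<Sum>s\<in>F. block_run S cl s0 x s) \<le> \<epsilon>))"
  shows "block_approximable L"
  unfolding block_approximable_def
proof (intro allI impI)
  fix \<epsilon> :: real assume "0 < \<epsilon>"
  then obtain S :: "'s set" and cl s0 F where S: "finite S" "s0 \<in> S" "F \<subseteq> S"
    and acc: "\<And>x. x \<in> L \<Longrightarrow> 1 - \<epsilon> \<le> (\<Sum>s\<in>F. block_run S cl s0 x s)"
      "\<And>x. x \<notin> L \<Longrightarrow> (\<Sum>s\<in>F. block_run S cl s0 x s) \<le> \<epsilon>"
    using assms by meson
  obtain h where h: "bij_betw h {0..<card S} S"
    using ex_bij_betw_nat_finite[OF S(1)] by blast
  then have h: "bij_betw h {..<card S} S"
    by (simp add: atLeast0LessThan)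
  then have "s0 \<in> h ` {..<card S}"
    using S(2) by (simp add: bij_betw_def)
  then obtain t0 where t0: "t0 < card S" "h t0 = s0"
    by auto
  define G where "G = {t. t < card S \<and> h t \<in> F}"
  have G: "bij_betw h G F"
    using h S(3) unfolding G_def bij_betw_def by (auto intro: inj_on_subset)
  have eq: "(\<Sum>s\<in>G. block_run {..<card S} (\<lambda>c. cl c \<circ> h) t0 x s) = (\<Sum>s\<in>F. block_run S cl s0 x s)" for x
  proof -
    have "(\<Sum>s\<in>G. block_run {..<card S} (\<lambda>c. cl c \<circ> h) t0 x s) = (\<Sum>s\<in>G. block_run S cl s0 x (h s))"
      using t0 by (intro sum.cong refl) (simp add: block_run_reindex[OF h] G_def)
    also have "\<dots> = (\<Sum>s\<in>F. block_run S cl s0 x s)"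
      by (rule sum.reindex_bij_betw[OF G])
    finally show ?thesis .
  qed
  show "\<exists>(m::nat) cl s0 F. s0 < m \<and> F \<subseteq> {..<m} \<and>
     (\<forall>x. (x \<in> L \<longrightarrow> 1 - \<epsilon> \<le> (\<Sum>s\<in>F. block_run {..<m} cl s0 x s)) \<and>
          (x \<notin> L \<longrightarrow> (\<Sum>s\<in>F. block_run {..<m} cl s0 x s) \<le> \<epsilon>))"
  proof (rule exI[of _ "card S"], rule exI[of _ "\<lambda>c. cl c \<circ> h"], rule exI[of _ t0],
      rule exI[of _ G], intro conjI allI impI)
    show "G \<subseteq> {..<card S}"
      by (auto simp: G_def)
  qed (simp_all only: t0 eq acc not_False_eq_True)
qed

section \<open>Closure under the boolean operations\<close>

lemma block_approximable_compl:
  assumes "block_approximable L"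
  shows "block_approximable (UNIV - L)"
  unfolding block_approximable_def
proof (intro allI impI)
  fix \<epsilon> :: real assume "0 < \<epsilon>"
  with assms obtain m :: nat and cl s0 F where m: "s0 < m" "F \<subseteq> {..<m}"
    and acc: "\<And>x. x \<in> L \<Longrightarrow> 1 - \<epsilon> \<le> (\<Sum>s\<in>F. block_run {..<m} cl s0 x s)"
      "\<And>x. x \<notin> L \<Longrightarrow> (\<Sum>s\<in>F. block_run {..<m} cl s0 x s) \<le> \<epsilon>"
    by (rule block_approximableE) (rule that)
  have "(\<Sum>s\<in>{..<m} - F. block_run {..<m} cl s0 x s) = 1 - (\<Sum>s\<in>F. block_run {..<m} cl s0 x s)" for x
    using m by (subst sum_diff) (auto simp: sum_block_run)
  note eq = this
  show "\<exists>(m::nat) cl s0 F. s0 < m \<and> F \<subseteq> {..<m} \<and>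
     (\<forall>x. (x \<in> UNIV - L \<longrightarrow> 1 - \<epsilon> \<le> (\<Sum>s\<in>F. block_run {..<m} cl s0 x s)) \<and>
          (x \<notin> UNIV - L \<longrightarrow> (\<Sum>s\<in>F. block_run {..<m} cl s0 x s) \<le> \<epsilon>))"
  proof (rule exI[of _ m], rule exI[of _ cl], rule exI[of _ s0], rule exI[of _ "{..<m} - F"],
      intro conjI allI impI)
    show "1 - \<epsilon> \<le> (\<Sum>s\<in>{..<m} - F. block_run {..<m} cl s0 x s)" if "x \<in> UNIV - L" for x
      using acc(2)[of x] that eq[of x] by simp
    show "(\<Sum>s\<in>{..<m} - F. block_run {..<m} cl s0 x s) \<le> \<epsilon>" if "x \<notin> UNIV - L" for x
      using acc(1)[of x] that eq[of x] by simp
  qed (use m in auto)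
qed

text \<open>The two automata run independently: blocks of the product are products of blocks, so the
  averages factor. \<open>prod_encode\<close> turns the pair of labels into a number.\<close>

lemma block_run_product:
  fixes cl :: "'a \<Rightarrow> 's \<Rightarrow> nat" and cl' :: "'a \<Rightarrow> 't \<Rightarrow> nat"
  defines "clp \<equiv> \<lambda>c p. prod_encode (cl c (fst p), cl' c (snd p))"
  shows "block_run (S \<times> T) clp (s0, t0) x (s, t) = block_run S cl s0 x s * block_run T cl' t0 x t"
proof (induction x arbitrary: s t rule: rev_induct)
  case (snoc c x)
  have "block (S \<times> T) clp c (s, t) = block S cl c s \<times> block T cl' c t"
    by (auto simp: block_def clp_def)
  moreover have "(\<Sum>p\<in>block S cl c s \<times> block T cl' c t. block_run (S \<times> T) clp (s0, t0) x p) =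
      (\<Sum>(u, v)\<in>block S cl c s \<times> block T cl' c t. block_run S cl s0 x u * block_run T cl' t0 x v)"
    by (intro sum.cong refl) (auto simp: snoc.IH)
  ultimately show ?case
    by (simp add: block_run_snoc block_step_def card_cartesian_product sum_product sum.cartesian_product)
qed (simp add: block_run_Nil)

lemma block_approximable_inter:
  assumes "block_approximable L" "block_approximable K"
  shows "block_approximable (L \<inter> K)"
proof (rule block_approximableI)
  fix \<epsilon> :: real assume "0 < \<epsilon>"
  then have half: "0 < \<epsilon> / 2" by simp
  obtain m :: nat and cl s0 F where m: "s0 < m" "F \<subseteq> {..<m}"
    and accL: "\<And>x. x \<in> L \<Longrightarrow> 1 - \<epsilon> / 2 \<le> (\<Sum>s\<in>F. block_run {..<m} cl s0 x s)"
      "\<And>x. x \<notin> L \<Longrightarrow> (\<Sum>s\<in>F. block_run {..<m} cl s0 x s) \<le> \<epsilon> / 2"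
    using assms(1) half by (rule block_approximableE) (rule that)
  obtain n :: nat and cl' t0 G where n: "t0 < n" "G \<subseteq> {..<n}"
    and accK: "\<And>x. x \<in> K \<Longrightarrow> 1 - \<epsilon> / 2 \<le> (\<Sum>s\<in>G. block_run {..<n} cl' t0 x s)"
      "\<And>x. x \<notin> K \<Longrightarrow> (\<Sum>s\<in>G. block_run {..<n} cl' t0 x s) \<le> \<epsilon> / 2"
    using assms(2) half by (rule block_approximableE) (rule that)
  define clp where "clp = (\<lambda>c p. prod_encode (cl c (fst p), cl' c (snd p)))"
  define a where "a x = (\<Sum>s\<in>F. block_run {..<m} cl s0 x s)" for x
  define b where "b x = (\<Sum>s\<in>G. block_run {..<n} cl' t0 x s)" for x
  have ab: "0 \<le> a x" "a x \<le> 1" "0 \<le> b x" "b x \<le> 1" for x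
    using m n by (auto simp: a_def b_def intro!: block_run_accept_le_1 sum_nonneg block_run_nonneg)
  have prod: "(\<Sum>p\<in>F \<times> G. block_run ({..<m} \<times> {..<n}) clp (s0, t0) x p) = a x * b x" for x
    unfolding clp_def a_def b_def
    by (simp add: sum_product sum.cartesian_product split_beta flip: block_run_product)
  have "1 - \<epsilon> \<le> a x * b x" if "x \<in> L \<inter> K" for x
  proof -
    have "(1 - a x) * (1 - b x) \<ge> 0"
      using ab by (intro mult_nonneg_nonneg) auto
    then have "a x + b x - 1 \<le> a x * b x"
      by (simp add: algebra_simps)
    moreover have "1 - \<epsilon> / 2 \<le> a x" "1 - \<epsilon> / 2 \<le> b x"
      using that accL(1) accK(1) by (auto simp: a_def b_def)
    ultimately show ?thesis by linarith
  qed
  moreover have "a x * b x \<le> \<epsilon>" if "x \<notin> L \<inter> K" for x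
  proof -
    have "a x \<le> \<epsilon> / 2 \<or> b x \<le> \<epsilon> / 2"
      using that accL(2) accK(2) by (auto simp: a_def b_def)
    moreover have "a x * b x \<le> a x" "a x * b x \<le> b x"
      using ab[of x] by (auto intro: mult_left_le mult_left_le_one_le)
    ultimately show ?thesis
      using \<open>0 < \<epsilon>\<close> by linarith
  qed
  ultimately have "\<And>x. x \<in> L \<inter> K \<Longrightarrow> 1 - \<epsilon> \<le> (\<Sum>p\<in>F \<times> G. block_run ({..<m} \<times> {..<n}) clp (s0, t0) x p)"
    "\<And>x. x \<notin> L \<inter> K \<Longrightarrow> (\<Sum>p\<in>F \<times> G. block_run ({..<m} \<times> {..<n}) clp (s0, t0) x p) \<le> \<epsilon>"
    by (simp_all only: prod)
  moreover have "F \<times> G \<subseteq> {..<m} \<times> {..<n}" "(s0, t0) \<in> {..<m} \<times> {..<n}" "finite ({..<m} \<times> {..<n})"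
    using m n by auto
  ultimately show "\<exists>(S::(nat \<times> nat) set) cl s0 F. finite S \<and> s0 \<in> S \<and> F \<subseteq> S \<and>
     (\<forall>x. (x \<in> L \<inter> K \<longrightarrow> 1 - \<epsilon> \<le> (\<Sum>s\<in>F. block_run S cl s0 x s)) \<and>
          (x \<notin> L \<inter> K \<longrightarrow> (\<Sum>s\<in>F. block_run S cl s0 x s) \<le> \<epsilon>))"
    by (intro exI[of _ "{..<m} \<times> {..<n}"] exI[of _ clp] exI[of _ "(s0, t0)"] exI[of _ "F \<times> G"]
        conjI allI impI)
qed

lemma block_approximable_union:
  assumes "block_approximable L" "block_approximable K"
  shows "block_approximable (L \<union> K)"
proof -
  have "L \<union> K = UNIV - ((UNIV - L) \<inter> (UNIV - K))" by blast
  then show ?thesis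
    using assms by (metis block_approximable_compl block_approximable_inter)
qed

lemma block_approximable_bool_closure:
  assumes "L \<in> bool_closure G" "\<And>K. K \<in> G \<Longrightarrow> block_approximable K"
  shows "block_approximable L"
  using assms by (induction rule: bool_closure.induct)
    (auto intro: block_approximable_compl block_approximable_union block_approximable_inter)

section \<open>Patterns are recognized by block averaging\<close>

text \<open>For the pattern \<open>a\<^sub>1 \<dots> a\<^sub>k\<close> the states form levels \<open>0, \<dots>, k\<close> of sizes \<open>N\<^sup>i\<close>, and the letter
  \<open>c\<close> merges the levels \<open>i - 1\<close> and \<open>i\<close> whenever \<open>a\<^sub>i = c\<close>; these pairs are disjoint since the
  pattern does not stutter. \<open>pattern_step\<close> is the effect on the probability \<open>q i\<close> of a single state of
  level \<open>i\<close>. As each level is much larger than the previous one, a merge moves almost all of the mass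
  upwards, and it never moves back because \<open>q\<close> stays decreasing.\<close>

definition pattern_states :: "'a list \<Rightarrow> nat \<Rightarrow> (nat \<times> nat) set" where
  "pattern_states as N = Sigma {..length as} (\<lambda>i. {..<N ^ i})"

text \<open>With indices from zero, \<open>as ! i\<close> joins level \<open>i\<close> to level
  \<open>Suc i\<close> under the label \<open>Suc i\<close>. Level \<open>Suc i\<close> keeps this
  label, since its own letter \<open>as ! Suc i\<close> differs from \<open>as ! i\<close>.\<close>

definition pattern_label :: "'a list \<Rightarrow> 'a \<Rightarrow> nat \<times> nat \<Rightarrow> nat" where
  "pattern_label as c p = (if fst p < length as \<and> as ! fst p = c then Suc (fst p) else fst p)"

definition pattern_step :: "'a list \<Rightarrow> nat \<Rightarrow> (nat \<Rightarrow> real) \<Rightarrow> 'a \<Rightarrow> nat \<Rightarrow> real" where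
  "pattern_step as N q c i =
    (if i < length as \<and> as ! i = c then (q i + N * q (Suc i)) / (1 + real N)
     else if 0 < i \<and> i \<le> length as \<and> as ! (i - 1) = c then (q (i - 1) + N * q i) / (1 + real N)
     else q i)"

definition pattern_density :: "'a list \<Rightarrow> nat \<Rightarrow> 'a list \<Rightarrow> nat \<Rightarrow> real" where
  "pattern_density as N x = foldl (pattern_step as N) (\<lambda>i. if i = 0 then 1 else 0) x"

lemma pattern_density_Nil: "pattern_density as N [] = (\<lambda>i. if i = 0 then 1 else 0)"
  by (simp add: pattern_density_def)

lemma pattern_density_snoc:
  "pattern_density as N (x @ [c]) = pattern_step as N (pattern_density as N x) c"
  by (simp add: pattern_density_def)

text \<open>The block of a state consists of one level or of two adjacent ones; \<open>J\<close>
  below is the set of these levels.\<close>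

lemma block_step_pattern:
  assumes nostut: "\<And>i. Suc i < length as \<Longrightarrow> as ! i \<noteq> as ! Suc i" and "0 < N"
    and p: "p \<in> pattern_states as N"
  shows "block_step (pattern_states as N) (pattern_label as) (\<lambda>p. q (fst p)) c p = pattern_step as N q c (fst p)"
proof -
  let ?k = "length as"
  define l where "l i = (if i < ?k \<and> as ! i = c then Suc i else i)" for i
  define i where "i = fst p"
  have "i \<le> ?k"
    using p by (auto simp: pattern_states_def i_def)
  define J where "J = {j. j \<le> ?k \<and> l j = l i}"
  have "finite J"
    by (simp add: J_def)
  have blk: "block (pattern_states as N) (pattern_label as) c p = Sigma J (\<lambda>i. {..<N ^ i})"
  proof -
    have "pattern_label as c r = l (fst r)" for r
      by (simp add: pattern_label_def l_def)
    then show ?thesis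
      by (auto simp: block_def pattern_states_def J_def i_def)
  qed
  have card: "card (Sigma J (\<lambda>i. {..<N ^ i})) = (\<Sum>j\<in>J. N ^ j)"
    using \<open>finite J\<close> by (simp add: card_SigmaI)
  have sum: "(\<Sum>p\<in>Sigma J (\<lambda>i. {..<N ^ i}). q (fst p)) = (\<Sum>j\<in>J. N ^ j * q j)"
    using \<open>finite J\<close> sum.Sigma[of J "\<lambda>i. {..<N ^ i}" "\<lambda>j _. q j"] by (simp add: split_beta)
  have step: "block_step (pattern_states as N) (pattern_label as) (\<lambda>p. q (fst p)) c p =
      (\<Sum>j\<in>J. N ^ j * q j) / (\<Sum>j\<in>J. N ^ j)"
    by (simp add: block_step_def blk card sum)
  \<comment> \<open>The common factor \<open>N ^ j\<close> cancels, which leaves the weights 1 and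
    \<open>N\<close>.\<close>
  have pair: "(real N ^ j * a + real N ^ Suc j * b) / (real N ^ j + real N ^ Suc j) = (a + N * b) / (1 + real N)"
    for j :: nat and a b :: real
  proof -
    have "(real N ^ j * a + real N ^ Suc j * b) / (real N ^ j + real N ^ Suc j) =
        (real N ^ j * (a + N * b)) / (real N ^ j * (1 + real N))"
      by (simp add: algebra_simps)
    also have "\<dots> = (a + N * b) / (1 + real N)"
      using \<open>0 < N\<close> by (intro mult_divide_mult_cancel_left) simp
    finally show ?thesis .
  qed
  consider "i < ?k" "as ! i = c" | "\<not> (i < ?k \<and> as ! i = c)" "0 < i" "as ! (i - 1) = c"
    | "\<not> (i < ?k \<and> as ! i = c)" "\<not> (0 < i \<and> as ! (i - 1) = c)"
    by blast
  then show ?thesis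
  proof cases
    case 1
    have "J = {i, Suc i}"
      using 1 nostut[of i] by (auto simp: J_def l_def split: if_splits)
    with 1 step pair[where j = i and a = "q i" and b = "q (Suc i)"] show ?thesis
      by (simp add: pattern_step_def i_def[symmetric])
  next
    case 2
    then obtain j where j: "i = Suc j" by (cases i) auto
    have "J = {j, Suc j}"
      using 2 \<open>i \<le> ?k\<close> by (auto simp: J_def l_def j split: if_splits)
    with 2 step pair[where j = j and a = "q j" and b = "q (Suc j)"] \<open>i \<le> ?k\<close> show ?thesis
      by (auto simp: pattern_step_def i_def[symmetric] j)
  next
    case 3
    have "l i = i"
      using 3 by (simp add: l_def)
    moreover have "j = i" if "l j = i" for j
      using that 3 by (cases "j < ?k \<and> as ! j = c") (auto simp: l_def)
    ultimately have "J = {i}"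
      using \<open>i \<le> ?k\<close> by (auto simp: J_def)
    with 3 step \<open>0 < N\<close> show ?thesis
      by (auto simp: pattern_step_def i_def[symmetric])
  qed
qed

text \<open>All states of a level keep equal probability, so one number per level describes the
  distribution.\<close>

lemma block_run_pattern:
  assumes nostut: "\<And>i. Suc i < length as \<Longrightarrow> as ! i \<noteq> as ! Suc i" and "0 < N"
    and "p \<in> pattern_states as N"
  shows "block_run (pattern_states as N) (pattern_label as) (0, 0) x p = pattern_density as N x (fst p)"
  using assms(3)
proof (induction x arbitrary: p rule: rev_induct)
  case Nil
  then show ?case
    by (cases p; cases "fst p") (auto simp: block_run_Nil pattern_density_Nil pattern_states_def)
next
  case (snoc c x)
  have "block_run (pattern_states as N) (pattern_label as) (0, 0) (x @ [c]) p =
      block_step (pattern_states as N) (pattern_label as) (\<lambda>p. pattern_density as N x (fst p)) c p"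
    unfolding block_run_snoc block_step_def
    by (rule arg_cong2[where f = "(/)"], rule sum.cong) (auto simp: block_def snoc.IH)
  also have "\<dots> = pattern_density as N (x @ [c]) (fst p)"
    unfolding pattern_density_snoc using block_step_pattern[OF nostut \<open>0 < N\<close> snoc.prems] by blast
  finally show ?case .
qed

section \<open>Flow of mass between the levels\<close>

definition mass_below :: "nat \<Rightarrow> (nat \<Rightarrow> real) \<Rightarrow> nat \<Rightarrow> real" where
  "mass_below N q i = (\<Sum>j<i. N ^ j * q j)"

lemma mass_below_simps [simp]:
  "mass_below N q 0 = 0" "mass_below N q (Suc i) = mass_below N q i + N ^ i * q i"
  by (simp_all add: mass_below_def)

text \<open>Only the merge of the levels \<open>i - 1\<close> and \<open>i\<close> moves mass across
  the boundary below level \<open>i\<close>. Every other merge takes place entirely on one side of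
  it.\<close>

lemma mass_below_step:
  assumes nostut: "\<And>i. Suc i < length as \<Longrightarrow> as ! i \<noteq> as ! Suc i" and "i \<le> Suc (length as)"
  shows "mass_below N (pattern_step as N q c) i =
    (if 0 < i \<and> i \<le> length as \<and> as ! (i - 1) = c
     then mass_below N q (i - 1) + N ^ (i - 1) * pattern_step as N q c (i - 1)
     else mass_below N q i)"
  using assms(2)
proof (induction i)
  case (Suc i)
  let ?k = "length as"
  have IH: "mass_below N (pattern_step as N q c) i =
    (if 0 < i \<and> i \<le> ?k \<and> as ! (i - 1) = c
     then mass_below N q (i - 1) + N ^ (i - 1) * pattern_step as N q c (i - 1)
     else mass_below N q i)"
    using Suc by simp
  show ?case
  proof (cases "i < ?k \<and> as ! i = c")
    case True
    then have "\<not> (0 < i \<and> as ! (i - 1) = c)"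
      using nostut[of "i - 1"] by (cases i) auto
    with IH True show ?thesis by auto
  next
    case False
    show ?thesis
    proof (cases "0 < i \<and> as ! (i - 1) = c")
      case True
      then obtain j where j: "i = Suc j" by (cases i) auto
      have "j < ?k" "as ! j = c"
        using True Suc.prems by (auto simp: j)
      with False have q: "pattern_step as N q c j = (q j + N * q (Suc j)) / (1 + real N)"
        "pattern_step as N q c (Suc j) = (q j + N * q (Suc j)) / (1 + real N)"
        by (auto simp: pattern_step_def j)
      \<comment> \<open>\<open>z\<close> is the common density after the merge; the computation
        shows that the total mass of the pair is preserved.\<close>
      define z where "z = (q j + N * q (Suc j)) / (1 + real N)"
      have "(1 + real N) * z = q j + N * q (Suc j)"
        by (simp add: z_def)
      then have "real N ^ j * ((1 + real N) * z) = real N ^ j * (q j + N * q (Suc j))"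
        by simp
      then have "real N ^ j * z + real N ^ Suc j * z = real N ^ j * q j + real N ^ Suc j * q (Suc j)"
        by (simp add: algebra_simps)
      then show ?thesis
        using IH False \<open>j < ?k\<close> \<open>as ! j = c\<close> by (auto simp: j q z_def Suc_le_eq)
    next
      case False2: False
      have "pattern_step as N q c i = q i"
        using False False2 by (auto simp: pattern_step_def)
      with IH False False2 show ?thesis by auto
    qed
  qed
qed simp

lemma weighted_mean_bounds:
  fixes a b n :: real
  assumes "b \<le> a" "0 \<le> n"
  shows "b \<le> (a + n * b) / (1 + n)" "(a + n * b) / (1 + n) \<le> a"
proof -
  have "n * b \<le> n * a"
    using assms by (intro mult_left_mono)
  with assms show "b \<le> (a + n * b) / (1 + n)" "(a + n * b) / (1 + n) \<le> a"
    by (simp_all add: pos_le_divide_eq pos_divide_le_eq algebra_simps)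
qed

text \<open>A level that is not yet reached is empty. When level \<open>i\<close> is first reached,
  at most \<open>1 / (1 + N)\<close> of mass is left on level \<open>i - 1\<close>; the decreasing
  densities prevent any later flow downwards, so these losses add up to at most
  \<open>i / (1 + N)\<close>.\<close>

lemma pattern_density_invariants:
  fixes as :: "'a list"
  assumes nostut: "\<And>i. Suc i < length as \<Longrightarrow> as ! i \<noteq> as ! Suc i" and "0 < N"
  defines "q \<equiv> \<lambda>x. pattern_density as N x"
  shows "(\<forall>i<length as. q x (Suc i) \<le> q x i) \<and> (\<forall>i\<le>length as. 0 \<le> q x i) \<and>
    mass_below N (q x) (Suc (length as)) = 1 \<and>
    (\<forall>i\<le>length as. \<not> subseq (take i as) x \<longrightarrow> q x i = 0) \<and>
    (\<forall>i\<le>length as. subseq (take i as) x \<longrightarrow> mass_below N (q x) i \<le> i / (1 + real N))"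
proof (induction x rule: rev_induct)
  case Nil
  have "mass_below N (q []) (Suc i) = 1" for i
    by (induction i) (simp_all add: q_def pattern_density_Nil)
  then have "mass_below N (q []) (Suc (length as)) = 1"
    by blast
  moreover have "i = 0" if "i \<le> length as" "subseq (take i as) []" for i
    using list_emb_Nil2[OF that(2)] that(1) by (cases as) auto
  then have "mass_below N (q []) i \<le> i / (1 + real N)" if "i \<le> length as" "subseq (take i as) []" for i
    using that by fastforce
  moreover have "q [] i = 0" if "\<not> subseq (take i as) []" for i
    using that by (auto simp: q_def pattern_density_Nil)
  moreover have "0 \<le> q [] i" "q [] (Suc i) \<le> q [] i" for i
    by (simp_all add: q_def pattern_density_Nil)
  ultimately show ?case
    by blast
next
  case (snoc c x)
  let ?k = "length as"
  let ?q' = "pattern_step as N (q x) c"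
  have q': "q (x @ [c]) = ?q'"
    by (simp add: q_def pattern_density_snoc)
  have dec: "\<And>i. i < ?k \<Longrightarrow> q x (Suc i) \<le> q x i" and nonneg: "\<And>i. i \<le> ?k \<Longrightarrow> 0 \<le> q x i"
    and total: "mass_below N (q x) (Suc ?k) = 1"
    and zero: "\<And>i. i \<le> ?k \<Longrightarrow> \<not> subseq (take i as) x \<Longrightarrow> q x i = 0"
    and small: "\<And>i. i \<le> ?k \<Longrightarrow> subseq (take i as) x \<Longrightarrow> mass_below N (q x) i \<le> i / (1 + real N)"
    using snoc by auto
  have mean: "q x (Suc i) \<le> (q x i + N * q x (Suc i)) / (1 + real N)"
    "(q x i + N * q x (Suc i)) / (1 + real N) \<le> q x i" if "i < ?k" for i
    using weighted_mean_bounds[OF dec[OF that], of N] by simp_all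
  have upper: "?q' i \<le> q x i" if "\<not> (0 < i \<and> as ! (i - 1) = c)" for i
    using that mean(2)[of i] by (auto simp: pattern_step_def)
  have lower: "q x i \<le> ?q' i" if "\<not> (i < ?k \<and> as ! i = c)" for i
    using that mean(1)[of "i - 1"] by (cases i) (auto simp: pattern_step_def)
  \<comment> \<open>If levels \<open>i\<close> and \<open>Suc i\<close> are not merged, level
    \<open>Suc i\<close> can only be merged upwards, which lowers its density, and level
    \<open>i\<close> only downwards, which raises it.\<close>
  have dec': "?q' (Suc i) \<le> ?q' i" if "i < ?k" for i
  proof (cases "as ! i = c")
    case True
    with that nostut[of i] show ?thesis by (auto simp: pattern_step_def)
  next
    case False
    then have "?q' (Suc i) \<le> q x (Suc i)"
      by (intro upper) simp
    also have "\<dots> \<le> q x i"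
      using that by (rule dec)
    also have "\<dots> \<le> ?q' i"
      using False by (intro lower) simp
    finally show ?thesis .
  qed
  have nonneg': "0 \<le> ?q' i" if "i \<le> ?k" for i
    using that nonneg[of i] nonneg[of "Suc i"] nonneg[of "i - 1"] by (auto simp: pattern_step_def)
  have total': "mass_below N ?q' (Suc ?k) = 1"
    using mass_below_step[OF nostut, of "Suc ?k" N "q x" c] total by (simp del: mass_below_simps)
  have take: "take i as = take (i - 1) as @ [as ! (i - 1)]" if "0 < i" "i \<le> ?k" for i
    using that take_Suc_conv_app_nth[of "i - 1" as] by simp
  have zero': "?q' i = 0" if i: "i \<le> ?k" and no: "\<not> subseq (take i as) (x @ [c])" for i
  proof -
    have qi: "q x i = 0"
      using i no by (intro zero) (auto intro: subseq_rev_drop_many)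
    have "q x (Suc i) = 0" if "i < ?k"
      using dec[OF that] nonneg[of "Suc i"] that qi by simp
    moreover have "q x (i - 1) = 0" if "0 < i" "as ! (i - 1) = c"
    proof (rule zero)
      show "\<not> subseq (take (i - 1) as) x"
        using no take[OF that(1) i] that by (auto simp: subseq_snoc_snoc)
    qed (use i in simp)
    ultimately show ?thesis
      using qi by (auto simp: pattern_step_def)
  qed
  have mass_mono: "mass_below N (q x) i \<le> mass_below N (q x) j" if "i \<le> j" "j \<le> Suc ?k" for i j
    unfolding mass_below_def using that
    by (intro sum_mono2) (auto intro!: mult_nonneg_nonneg nonneg)
  have small': "mass_below N ?q' i \<le> i / (1 + real N)" if i: "i \<le> ?k" and sub: "subseq (take i as) (x @ [c])" for i
  proof (cases "0 < i \<and> as ! (i - 1) = c")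
    case True
    then obtain j where j: "i = Suc j" by (cases i) auto
    have jk: "j < ?k" "as ! j = c"
      using True i by (auto simp: j)
    have step: "mass_below N ?q' i = mass_below N (q x) j + N ^ j * ?q' j"
      using mass_below_step[OF nostut, of i N "q x" c] i jk by (simp add: j)
    have q'j: "?q' j = (q x j + N * q x (Suc j)) / (1 + real N)"
      using jk by (simp add: pattern_step_def)
    show ?thesis
    proof (cases "subseq (take i as) x")
      case True
      \<comment> \<open>Level \<open>i\<close> was reached before: by monotonicity the merge does
        not raise the density of level \<open>j\<close>, so nothing flows back.\<close>
      have "mass_below N ?q' i \<le> mass_below N (q x) j + N ^ j * q x j"
        unfolding step q'j using mean(2)[OF jk(1)] by (intro add_left_mono mult_left_mono) auto
      also have "\<dots> = mass_below N (q x) i"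
        by (simp add: j)
      also have "\<dots> \<le> i / (1 + real N)"
        using i True by (rule small)
      finally show ?thesis .
    next
      case False
      have "subseq (take j as) x"
        using sub take[of i] i jk by (simp add: j subseq_snoc_snoc)
      then have "mass_below N (q x) j \<le> j / (1 + real N)"
        using jk by (intro small) auto
      \<comment> \<open>Level \<open>i\<close> is reached only now: the sizes of the merged levels
        are as 1 to \<open>N\<close>, so level \<open>j\<close> keeps the share
        \<open>1 / (1 + N)\<close> of their mass.\<close>
      moreover have "N ^ j * ?q' j \<le> 1 / (1 + real N)"
      proof -
        have "N ^ j * ?q' j = (N ^ j * q x j + N ^ Suc j * q x (Suc j)) / (1 + real N)"
          by (simp add: q'j algebra_simps)
        also have "\<dots> \<le> 1 / (1 + real N)"
        proof (rule divide_right_mono)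
          have "N ^ j * q x j + N ^ Suc j * q x (Suc j) =
              mass_below N (q x) (Suc (Suc j)) - mass_below N (q x) j"
            by simp
          also have "\<dots> \<le> 1"
            using mass_mono[of "Suc (Suc j)" "Suc ?k"] mass_mono[of 0 j] total jk by (simp del: mass_below_simps(2))
          finally show "N ^ j * q x j + N ^ Suc j * q x (Suc j) \<le> 1" .
        qed simp
        finally show ?thesis .
      qed
      ultimately show ?thesis
        unfolding step by (simp add: j add_divide_distrib)
    qed
  next
    case False
    have "subseq (take i as) x"
    proof (cases "i = 0")
      case False2: False
      with False have "as ! (i - 1) \<noteq> c" by simp
      with sub take[of i] False2 i show ?thesis
        by (auto simp: subseq_snoc_snoc split: if_splits)
    qed simp
    then show ?thesis
      using mass_below_step[OF nostut, of i N "q x" c] small[OF i] False i by auto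
  qed
  show ?case
    unfolding q' using dec' nonneg' total' zero' small' by blast
qed

theorem pattern_lang_block_approximable:
  assumes nostut: "\<And>i. Suc i < length as \<Longrightarrow> as ! i \<noteq> as ! Suc i"
  shows "block_approximable (pattern_lang as)"
proof (rule block_approximableI)
  fix \<epsilon> :: real assume "0 < \<epsilon>"
  let ?k = "length as"
  \<comment> \<open>\<open>N\<close> is chosen so that the mass left below the top level, at most
    \<open>?k / (1 + N)\<close>, does not exceed \<open>\<epsilon>\<close>.\<close>
  obtain N :: nat where "?k / \<epsilon> < N"
    using reals_Archimedean2 by blast
  then have "?k < N * \<epsilon>"
    using \<open>0 < \<epsilon>\<close> by (simp add: pos_divide_less_eq)
  then have "?k \<le> \<epsilon> * (1 + real N)"
    using \<open>0 < \<epsilon>\<close> by (simp add: algebra_simps)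
  then have bound: "?k / (1 + real N) \<le> \<epsilon>"
    by (simp add: pos_divide_le_eq)
  have "0 < N"
    using \<open>?k < N * \<epsilon>\<close> by (cases N) auto
  define F where "F = {?k} \<times> {..<N ^ ?k}"
  have F: "F \<subseteq> pattern_states as N"
    by (auto simp: F_def pattern_states_def)
  have acc: "(\<Sum>p\<in>F. block_run (pattern_states as N) (pattern_label as) (0, 0) x p) =
      N ^ ?k * pattern_density as N x ?k" for x
  proof -
    have "(\<Sum>p\<in>F. block_run (pattern_states as N) (pattern_label as) (0, 0) x p) =
        (\<Sum>p\<in>F. pattern_density as N x (fst p))"
      using F by (intro sum.cong refl block_run_pattern[OF nostut \<open>0 < N\<close>]) auto
    also have "\<dots> = (\<Sum>p\<in>F. pattern_density as N x ?k)"
      by (intro sum.cong) (auto simp: F_def)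
    also have "\<dots> = N ^ ?k * pattern_density as N x ?k"
      by (simp add: F_def card_cartesian_product)
    finally show ?thesis .
  qed
  have inv: "mass_below N (pattern_density as N x) (Suc ?k) = 1"
    "\<not> subseq (take ?k as) x \<Longrightarrow> pattern_density as N x ?k = 0"
    "subseq (take ?k as) x \<Longrightarrow> mass_below N (pattern_density as N x) ?k \<le> ?k / (1 + real N)" for x
    using pattern_density_invariants[OF nostut \<open>0 < N\<close>, of x] by blast+
  have "1 - \<epsilon> \<le> N ^ ?k * pattern_density as N x ?k" if "x \<in> pattern_lang as" for x
    using inv(1)[of x] inv(3)[of x] bound that by (simp add: pattern_lang_subseq)
  moreover have "N ^ ?k * pattern_density as N x ?k \<le> \<epsilon>" if "x \<notin> pattern_lang as" for x
    using inv(2)[of x] that \<open>0 < \<epsilon>\<close> by (simp add: pattern_lang_subseq)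
  ultimately have "\<And>x. x \<in> pattern_lang as \<Longrightarrow>
      1 - \<epsilon> \<le> (\<Sum>p\<in>F. block_run (pattern_states as N) (pattern_label as) (0, 0) x p)"
    "\<And>x. x \<notin> pattern_lang as \<Longrightarrow>
      (\<Sum>p\<in>F. block_run (pattern_states as N) (pattern_label as) (0, 0) x p) \<le> \<epsilon>"
    by (simp_all only: acc)
  moreover have "finite (pattern_states as N)" "(0, 0) \<in> pattern_states as N"
    by (auto simp: pattern_states_def)
  ultimately show "\<exists>(S::(nat \<times> nat) set) cl s0 F. finite S \<and> s0 \<in> S \<and> F \<subseteq> S \<and>
     (\<forall>x. (x \<in> pattern_lang as \<longrightarrow> 1 - \<epsilon> \<le> (\<Sum>s\<in>F. block_run S cl s0 x s)) \<and>
          (x \<notin> pattern_lang as \<longrightarrow> (\<Sum>s\<in>F. block_run S cl s0 x s) \<le> \<epsilon>))"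
    using F
    by (intro exI[of _ "pattern_states as N"] exI[of _ "pattern_label as"] exI[of _ "(0, 0)"] exI[of _ F]
        conjI allI impI)
qed

section \<open>Block averaging by measurements\<close>

text \<open>For \<open>d \<noteq> 0\<close> the terms are the powers of an \<open>N\<close>-th root
  of unity other than 1, because \<open>\<bar>d\<bar> < N\<close>; their geometric sum
  vanishes.\<close>

lemma sum_cis_multiples:
  fixes d :: int
  assumes "0 < N" "\<bar>d\<bar> < int N"
  shows "(\<Sum>k<N. cis (2 * pi * d * real k / N)) = (if d = 0 then of_nat N else 0)"
proof (cases "d = 0")
  case False
  define z where "z = cis (2 * pi * d / N)"
  have pow: "cis (2 * pi * d * real k / N) = z ^ k" for k
    unfolding z_def DeMoivre by (simp add: mult_ac)
  have "z ^ N = cis (2 * pi * d)"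
    unfolding z_def DeMoivre using assms(1) by simp
  then have "z ^ N = 1"
    by (simp add: complex_eq_iff)
  have "z \<noteq> 1"
  proof
    assume "z = 1"
    then have "cos (2 * pi * d / N) = 1"
      by (simp add: z_def complex_eq_iff)
    then obtain n :: int where "2 * pi * d / N = n * 2 * pi"
      by (auto simp: cos_one_2pi_int)
    then have "real_of_int d = real_of_int (n * int N)"
      using assms(1) by (simp add: field_simps)
    then have d: "d = n * int N"
      by (simp only: of_int_eq_iff)
    with False have "1 \<le> \<bar>n\<bar>" by auto
    then have "int N \<le> \<bar>n\<bar> * int N"
      using mult_right_mono[of 1 "\<bar>n\<bar>" "int N"] by simp
    with d assms(2) show False by (simp add: abs_mult)
  qed
  then show ?thesis
    using False \<open>z ^ N = 1\<close> by (simp add: pow geometric_sum)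
qed simp

text \<open>\<open>U\<close> is the block-diagonal discrete Fourier matrix. Its entries have
  constant modulus on each block, so a measurement spreads a diagonal state evenly. Its symmetry
  will give completeness from orthonormality.\<close>

lemma fourier_block_basis:
  fixes l :: "nat \<Rightarrow> nat"
  obtains U :: "nat \<Rightarrow> nat \<Rightarrow> complex" where
    "\<And>s t. s < m \<Longrightarrow> t < m \<Longrightarrow> (\<Sum>i<m. U s i * cnj (U t i)) = (if s = t then 1 else 0)"
    "\<And>s i. s < m \<Longrightarrow> i < m \<Longrightarrow> U s i = U i s"
    "\<And>s i. s < m \<Longrightarrow> i < m \<Longrightarrow> U s i * cnj (U s i) =
      (if l i = l s then 1 / of_nat (card {t \<in> {..<m}. l t = l s}) else 0)"
    "\<And>s i. s < m \<Longrightarrow> i < m \<Longrightarrow> l s \<noteq> l i \<Longrightarrow> U s i = 0"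
proof -
  define B where "B b = {t \<in> {..<m}. l t = b}" for b
  have "\<forall>b. \<exists>h. bij_betw h (B b) {0..<card (B b)}"
    by (intro allI ex_bij_betw_finite_nat) (simp add: B_def)
  then obtain h where "\<forall>b. bij_betw (h b) (B b) {0..<card (B b)}"
    by (rule choice[THEN exE])
  then have h: "bij_betw (h b) (B b) {0..<card (B b)}" for b ..
  \<comment> \<open>\<open>pos s\<close> numbers the elements within the block of \<open>s\<close>
    from zero and serves as the frequency index.\<close>
  define pos where "pos s = h (l s) s" for s
  define N where "N s = card (B (l s))" for s
  define U where "U s i = (if l s = l i then cis (2 * pi * pos s * pos i / N s) / sqrt (N s) else 0)" for s i
  have Npos: "0 < N s" if "s < m" for s
    using that by (auto simp: N_def B_def card_gt_0_iff)
  have bij: "bij_betw pos (B (l s)) {..<N s}" for s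
  proof -
    have "bij_betw pos (B (l s)) {0..<N s} \<longleftrightarrow> bij_betw (h (l s)) (B (l s)) {0..<N s}"
      by (rule bij_betw_cong) (simp add: pos_def B_def)
    with h[of "l s"] show ?thesis
      by (simp add: N_def atLeast0LessThan)
  qed
  have entry: "U s i * cnj (U t i) =
      (if l s = l i then cis (2 * pi * (int (pos s) - int (pos t)) * real (pos i) / N s) / N s else 0)"
    if "l s = l t" for s t i
  proof (cases "l s = l i")
    case True
    have "N t = N s"
      using that by (simp add: N_def)
    have "cis (2 * pi * pos s * pos i / N s) * cnj (cis (2 * pi * pos t * pos i / N s)) =
        cis (2 * pi * (int (pos s) - int (pos t)) * real (pos i) / N s)"
      by (simp add: cis_cnj cis_mult diff_divide_distrib[symmetric] algebra_simps)
    moreover have "complex_of_real (sqrt (N s)) * complex_of_real (sqrt (N s)) = of_nat (N s)"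
      by (simp flip: of_real_mult)
    ultimately show ?thesis
      using True that \<open>N t = N s\<close> by (simp add: U_def)
  qed (use that in \<open>simp add: U_def\<close>)
  have orth: "(\<Sum>i<m. U s i * cnj (U t i)) = (if s = t then 1 else 0)" if st: "s < m" "t < m" for s t
  proof (cases "l s = l t")
    case False
    have "U s i * cnj (U t i) = 0" for i
      using False by (auto simp: U_def)
    then have "(\<Sum>i<m. U s i * cnj (U t i)) = 0"
      by (intro sum.neutral ballI)
    with False show ?thesis by auto
  next
    case True
    have "s \<in> B (l s)" "t \<in> B (l s)"
      using st True by (auto simp: B_def)
    then have mem: "pos s < N s" "pos t < N s" and inj: "pos s = pos t \<longleftrightarrow> s = t"
      using bij[of s] by (auto simp: bij_betw_def inj_on_eq_iff)
    define d where "d = int (pos s) - int (pos t)"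
    have d: "\<bar>d\<bar> < int (N s)"
      using mem by (simp add: d_def)
    have "(\<Sum>i<m. U s i * cnj (U t i)) =
        (\<Sum>i<m. if l i = l s then cis (2 * pi * d * real (pos i) / N s) / N s else 0)"
      using entry[OF True] by (intro sum.cong) (auto simp: d_def)
    also have "\<dots> = (\<Sum>i\<in>B (l s). cis (2 * pi * d * real (pos i) / N s) / N s)"
      unfolding B_def by (rule sum.inter_filter[symmetric]) simp
    also have "\<dots> = (\<Sum>k<N s. cis (2 * pi * d * real k / N s) / N s)"
      by (rule sum.reindex_bij_betw[OF bij])
    also have "\<dots> = (\<Sum>k<N s. cis (2 * pi * d * real k / N s)) / N s"
      by (simp add: sum_divide_distrib)
    also have "\<dots> = (if s = t then 1 else 0)"
      using sum_cis_multiples[OF Npos[OF st(1)] d] Npos[OF st(1)] inj by (auto simp: d_def)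
    finally show ?thesis .
  qed
  show thesis
  proof (rule that[of U])
    show "(\<Sum>i<m. U s i * cnj (U t i)) = (if s = t then 1 else 0)" if "s < m" "t < m" for s t
      using that by (rule orth)
    show "U s i = U i s" for s i
      by (auto simp: U_def N_def mult_ac)
    show "U s i * cnj (U s i) = (if l i = l s then 1 / of_nat (card {t \<in> {..<m}. l t = l s}) else 0)" for s i
      using entry[of s s i] by (auto simp: N_def B_def)
    show "U s i = 0" if "l s \<noteq> l i" for s i
      using that by (simp add: U_def)
  qed
qed

text \<open>For the rank-one matrix \<open>P\<close> built from \<open>u\<close>,
  \<open>P X P\<close> is \<open>P\<close> scaled by the expectation of \<open>X\<close> at
  \<open>u\<close>.\<close>

lemma mmult_rank_one:
  "mmult m (mmult m (\<lambda>i j. u i * cnj (u j)) X) (\<lambda>i j. u i * cnj (u j)) i j =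
    u i * cnj (u j) * (\<Sum>k<m. \<Sum>l<m. cnj (u k) * X k l * u l)"
proof -
  have "mmult m (mmult m (\<lambda>i j. u i * cnj (u j)) X) (\<lambda>i j. u i * cnj (u j)) i j =
      (\<Sum>l<m. \<Sum>k<m. u i * cnj (u j) * (cnj (u k) * X k l * u l))"
    unfolding mmult_def sum_distrib_right by (intro sum.cong refl) (simp add: mult_ac)
  also have "\<dots> = u i * cnj (u j) * (\<Sum>l<m. \<Sum>k<m. cnj (u k) * X k l * u l)"
    by (simp add: sum_distrib_left)
  also have "(\<Sum>l<m. \<Sum>k<m. cnj (u k) * X k l * u l) = (\<Sum>k<m. \<Sum>l<m. cnj (u k) * X k l * u l)"
    by (rule sum.swap)
  finally show ?thesis .
qed

text \<open>The eigenvalue \<open>real s\<close> belongs to the basis vector \<open>U c s\<close>; \<open>nat \<lfloor>r\<rfloor>\<close> recovers \<open>s\<close>.\<close>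

definition basis_qfa :: "nat \<Rightarrow> nat \<Rightarrow> ('a option \<Rightarrow> nat \<Rightarrow> nat \<Rightarrow> complex) \<Rightarrow> nat set \<Rightarrow> 'a mon_qfa" where
  "basis_qfa m s0 U F = \<lparr>dim = m, init = (\<lambda>j. if j = s0 then 1 else 0),
     obs = (\<lambda>c i j. \<Sum>r\<in>real ` {..<m}. complex_of_real r * (U c (nat \<lfloor>r\<rfloor>) i * cnj (U c (nat \<lfloor>r\<rfloor>) j))),
     eigs = (\<lambda>c. real ` {..<m}),
     proj = (\<lambda>c r i j. U c (nat \<lfloor>r\<rfloor>) i * cnj (U c (nat \<lfloor>r\<rfloor>) j)),
     acc = real ` F\<rparr>"

lemma basis_qfa_simps [simp]:
  "dim (basis_qfa m s0 U F) = m"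
  "init (basis_qfa m s0 U F) = (\<lambda>j. if j = s0 then 1 else 0)"
  "eigs (basis_qfa m s0 U F) c = real ` {..<m}"
  "proj (basis_qfa m s0 U F) c r = (\<lambda>i j. U c (nat \<lfloor>r\<rfloor>) i * cnj (U c (nat \<lfloor>r\<rfloor>) j))"
  "acc (basis_qfa m s0 U F) = real ` F"
  "obs (basis_qfa m s0 U F) c =
    (\<lambda>i j. \<Sum>r\<in>real ` {..<m}. complex_of_real r * (U c (nat \<lfloor>r\<rfloor>) i * cnj (U c (nat \<lfloor>r\<rfloor>) j)))"
  by (simp_all add: basis_qfa_def)

lemma is_mon_qfa_basis_qfa:
  assumes orth: "\<And>c s t. s < m \<Longrightarrow> t < m \<Longrightarrow> (\<Sum>i<m. U c s i * cnj (U c t i)) = (if s = t then 1 else 0)"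
    and complete: "\<And>c i j. i < m \<Longrightarrow> j < m \<Longrightarrow> (\<Sum>s<m. U c s i * cnj (U c s j)) = (if i = j then 1 else 0)"
    and "s0 < m" "F \<subseteq> {..<m}"
  shows "is_mon_qfa (basis_qfa m s0 U F)"
proof -
  let ?P = "\<lambda>c s i j. U c s i * cnj (U c s j)"
  have prod: "mmult m (?P c s) (?P c t) i j = (if s = t then ?P c s i j else 0)" if "s < m" "t < m" for c s t i j
  proof -
    have "mmult m (?P c s) (?P c t) i j = U c s i * cnj (U c t j) * (\<Sum>k<m. U c t k * cnj (U c s k))"
      by (simp add: mmult_def sum_distrib_left mult_ac)
    with that show ?thesis by (simp add: orth)
  qed
  have nonzero: "\<not> meq m (?P c s) mzero" if "s < m" for c s
  proof
    assume "meq m (?P c s) mzero"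
    then have "(\<Sum>i<m. ?P c s i i) = (\<Sum>i<m. 0)"
      unfolding meq_def mzero_def by (intro sum.cong refl) blast
    with orth[OF that that, of c] show False by simp
  qed
  have herm: "hermitian m (\<lambda>i j. \<Sum>r\<in>real ` {..<m}. complex_of_real r * ?P c (nat \<lfloor>r\<rfloor>) i j)" for c
    by (simp add: hermitian_def mult_ac)
  have sum: "(\<Sum>r\<in>real ` {..<m}. ?P c (nat \<lfloor>r\<rfloor>) i j) = (\<Sum>s<m. ?P c s i j)" for c i j
    by (subst sum.reindex) (auto simp: inj_on_def)
  show ?thesis
    unfolding is_mon_qfa_def Let_def basis_qfa_simps
  proof (intro conjI allI ballI impI)
    show "(\<Sum>j<m. (cmod (if j = s0 then 1 else 0))\<^sup>2) = 1"
      using \<open>s0 < m\<close> by (simp add: if_distrib[of cmod] if_distrib[of "\<lambda>x. x\<^sup>2"] cong: if_cong)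
    show "hermitian m (\<lambda>i j. \<Sum>r\<in>real ` {..<m}. complex_of_real r * (U c (nat \<lfloor>r\<rfloor>) i * cnj (U c (nat \<lfloor>r\<rfloor>) j)))" for c
      by (rule herm)
    show "orth_projector m (\<lambda>i j. U c (nat \<lfloor>r\<rfloor>) i * cnj (U c (nat \<lfloor>r\<rfloor>) j))" if "r \<in> real ` {..<m}" for c r
      using that by (auto simp: orth_projector_def hermitian_def meq_def prod)
    show "\<not> meq m (\<lambda>i j. U c (nat \<lfloor>r\<rfloor>) i * cnj (U c (nat \<lfloor>r\<rfloor>) j)) mzero" if "r \<in> real ` {..<m}" for c r
      using that nonzero by auto
    show "meq m (mmult m (\<lambda>i j. U c (nat \<lfloor>r\<rfloor>) i * cnj (U c (nat \<lfloor>r\<rfloor>) j))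
        (\<lambda>i j. U c (nat \<lfloor>s\<rfloor>) i * cnj (U c (nat \<lfloor>s\<rfloor>) j))) mzero"
      if "r \<in> real ` {..<m}" "s \<in> real ` {..<m}" "r \<noteq> s" for c r s
      using that by (auto simp: meq_def mzero_def prod)
    show "meq m (\<lambda>i j. \<Sum>r\<in>real ` {..<m}. U c (nat \<lfloor>r\<rfloor>) i * cnj (U c (nat \<lfloor>r\<rfloor>) j)) mid" for c
      by (simp add: meq_def mid_def sum complete)
  qed (use \<open>F \<subseteq> {..<m}\<close> in \<open>auto simp: meq_def\<close>)
qed

text \<open>The expectation of a diagonal state at a basis vector is the average over its block, the
  same for all vectors of the block. Only vectors from the block of \<open>i\<close> contribute to
  row \<open>i\<close>, so the average factors out and completeness leaves a diagonal
  matrix.\<close>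

lemma qstep_basis_qfa_diagonal:
  assumes complete: "\<And>i j. i < m \<Longrightarrow> j < m \<Longrightarrow> (\<Sum>s<m. U c s i * cnj (U c s j)) = (if i = j then 1 else 0)"
    and modulus: "\<And>s i. s < m \<Longrightarrow> i < m \<Longrightarrow> U c s i * cnj (U c s i) =
      (if l i = l s then 1 / of_nat (card {t \<in> {..<m}. l t = l s}) else 0)"
    and support: "\<And>s i. s < m \<Longrightarrow> i < m \<Longrightarrow> l s \<noteq> l i \<Longrightarrow> U c s i = 0"
    and diag: "\<And>i j. i < m \<Longrightarrow> j < m \<Longrightarrow> X i j = (if i = j then complex_of_real (\<rho> i) else 0)"
    and ij: "i < m" "j < m"
  shows "qstep (basis_qfa m s0 U F) X c i j =
    (if i = j then complex_of_real ((\<Sum>t\<in>{t \<in> {..<m}. l t = l i}. \<rho> t) / card {t \<in> {..<m}. l t = l i}) else 0)"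
proof -
  define avg where "avg s = complex_of_real ((\<Sum>t\<in>{t \<in> {..<m}. l t = l s}. \<rho> t) / card {t \<in> {..<m}. l t = l s})" for s
  have inner: "(\<Sum>k<m. \<Sum>t<m. cnj (U c s k) * X k t * U c s t) = avg s" if "s < m" for s
  proof -
    have "(\<Sum>k<m. \<Sum>t<m. cnj (U c s k) * X k t * U c s t) =
        (\<Sum>k<m. \<Sum>t<m. if k = t then U c s k * cnj (U c s k) * \<rho> k else 0)"
      by (intro sum.cong refl) (simp add: diag)
    also have "\<dots> = (\<Sum>k<m. U c s k * cnj (U c s k) * \<rho> k)"
      by simp
    also have "\<dots> = (\<Sum>k<m. if l k = l s then complex_of_real (\<rho> k) / card {t \<in> {..<m}. l t = l s} else 0)"
      using that by (intro sum.cong refl) (simp add: modulus)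
    also have "\<dots> = (\<Sum>k\<in>{t \<in> {..<m}. l t = l s}. complex_of_real (\<rho> k) / card {t \<in> {..<m}. l t = l s})"
      by (rule sum.inter_filter[symmetric]) simp
    also have "\<dots> = avg s"
      by (simp add: avg_def sum_divide_distrib)
    finally show ?thesis .
  qed
  have "qstep (basis_qfa m s0 U F) X c i j =
      (\<Sum>s<m. U c s i * cnj (U c s j) * (\<Sum>k<m. \<Sum>t<m. cnj (U c s k) * X k t * U c s t))"
    unfolding qstep_def basis_qfa_simps mmult_rank_one
    by (subst sum.reindex) (auto simp: inj_on_def)
  also have "\<dots> = (\<Sum>s<m. U c s i * cnj (U c s j) * avg i)"
  proof (intro sum.cong refl)
    fix s assume "s \<in> {..<m}"
    then have s: "s < m" by simp
    show "U c s i * cnj (U c s j) * (\<Sum>k<m. \<Sum>t<m. cnj (U c s k) * X k t * U c s t) =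
        U c s i * cnj (U c s j) * avg i"
    proof (cases "l s = l i")
      case True
      then show ?thesis
        unfolding inner[OF s] by (simp add: avg_def)
    next
      case False
      then show ?thesis
        using support[OF s ij(1)] by simp
    qed
  qed
  also have "\<dots> = (\<Sum>s<m. U c s i * cnj (U c s j)) * avg i"
    by (simp add: sum_distrib_right)
  finally show ?thesis
    using complete[OF ij] by (simp add: avg_def)
qed

text \<open>The second hypothesis makes \<open>u\<close> the standard basis vector \<open>s\<close>
  up to a phase.\<close>

lemma mtrace_diagonal_projector:
  assumes "\<And>i j. i < m \<Longrightarrow> j < m \<Longrightarrow> X i j = (if i = j then complex_of_real (\<rho> i) else 0)"
    and "\<And>i. i < m \<Longrightarrow> u i * cnj (u i) = (if i = s then 1 else 0)" and "s < m"
  shows "mtrace m (mmult m (\<lambda>i j. u i * cnj (u j)) X) = complex_of_real (\<rho> s)"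
proof -
  have "mtrace m (mmult m (\<lambda>i j. u i * cnj (u j)) X) =
      (\<Sum>i<m. \<Sum>k<m. if k = i then u i * cnj (u i) * complex_of_real (\<rho> i) else 0)"
    unfolding mtrace_def mmult_def by (intro sum.cong refl) (simp add: assms(1))
  also have "\<dots> = (\<Sum>i<m. u i * cnj (u i) * complex_of_real (\<rho> i))"
    by simp
  also have "\<dots> = (\<Sum>i<m. if i = s then complex_of_real (\<rho> s) else 0)"
    by (intro sum.cong refl) (simp add: assms(2))
  also have "\<dots> = complex_of_real (\<rho> s)"
    using assms(3) by simp
  finally show ?thesis .
qed

text \<open>The end marker gets singleton blocks, so that it measures the standard basis.\<close>

lemma block_run_realizable:
  fixes cl :: "'a \<Rightarrow> nat \<Rightarrow> nat"
  assumes "s0 < m" "F \<subseteq> {..<m}"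
  shows "\<exists>A :: 'a mon_qfa. is_mon_qfa A \<and> (\<forall>x. acc_prob A x = (\<Sum>s\<in>F. block_run {..<m} cl s0 x s))"
proof -
  define lab where "lab c = (case c of None \<Rightarrow> id | Some a \<Rightarrow> cl a)" for c
  \<comment> \<open>\<open>Q\<close> bundles the properties of the Fourier basis so that one
    application of choice yields a basis for every symbol.\<close>
  define Q where "Q c V \<longleftrightarrow> (\<forall>s<m. \<forall>t<m. (\<Sum>i<m. V s i * cnj (V t i)) = (if s = t then 1 else 0)) \<and>
      (\<forall>s<m. \<forall>i<m. V s i = V i s) \<and>
      (\<forall>s<m. \<forall>i<m. V s i * cnj (V s i) =
        (if lab c i = lab c s then 1 / of_nat (card {t \<in> {..<m}. lab c t = lab c s}) else 0)) \<and>
      (\<forall>s<m. \<forall>i<m. lab c s \<noteq> lab c i \<longrightarrow> V s i = 0)" for c V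
  have "\<exists>V. Q c V" for c
    by (rule fourier_block_basis[of m "lab c"], rule exI, unfold Q_def) (intro conjI allI impI; assumption | blast)
  then have "\<forall>c. \<exists>V. Q c V" ..
  then obtain U where "\<forall>c. Q c (U c)"
    by (rule choice[THEN exE])
  then have Q: "Q c (U c)" for c ..
  have orth: "(\<Sum>i<m. U c s i * cnj (U c t i)) = (if s = t then 1 else 0)" if "s < m" "t < m" for c s t
    using Q[of c] that unfolding Q_def by blast
  have sym: "U c s i = U c i s" if "s < m" "i < m" for c s i
    using Q[of c] that unfolding Q_def by blast
  have modulus: "U c s i * cnj (U c s i) =
      (if lab c i = lab c s then 1 / of_nat (card {t \<in> {..<m}. lab c t = lab c s}) else 0)" if "s < m" "i < m" for c s i
    using Q[of c] that unfolding Q_def by blast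
  have support: "U c s i = 0" if "s < m" "i < m" "lab c s \<noteq> lab c i" for c s i
    using Q[of c] that unfolding Q_def by blast
  have complete: "(\<Sum>s<m. U c s i * cnj (U c s j)) = (if i = j then 1 else 0)" if "i < m" "j < m" for c i j
  proof -
    \<comment> \<open>By symmetry the column relations are row relations, so completeness is
      orthonormality again.\<close>
    have "(\<Sum>s<m. U c s i * cnj (U c s j)) = (\<Sum>s<m. U c i s * cnj (U c j s))"
      using that by (intro sum.cong refl) (simp add: sym[of _ i] sym[of _ j])
    with orth[OF that] show ?thesis by simp
  qed
  let ?A = "basis_qfa m s0 U F"
  have qfa: "is_mon_qfa ?A"
    using orth complete assms by (intro is_mon_qfa_basis_qfa)
  have state: "rho_final ?A x i j = (if i = j then complex_of_real (block_run {..<m} cl s0 x i) else 0)"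
    if "i < m" "j < m" for x i j
    using that
  proof (induction x arbitrary: i j rule: rev_induct)
    case Nil
    then show ?case
      by (auto simp: rho_final_def rho0_def block_run_Nil)
  next
    case (snoc a x)
    have "rho_final ?A (x @ [a]) i j = qstep ?A (rho_final ?A x) (Some a) i j"
      by (simp add: rho_final_def)
    also have "\<dots> = (if i = j then complex_of_real
        ((\<Sum>t\<in>{t \<in> {..<m}. lab (Some a) t = lab (Some a) i}. block_run {..<m} cl s0 x t) /
          card {t \<in> {..<m}. lab (Some a) t = lab (Some a) i}) else 0)"
      by (rule qstep_basis_qfa_diagonal) (use complete modulus support snoc in auto)
    also have "\<dots> = (if i = j then complex_of_real (block_run {..<m} cl s0 (x @ [a]) i) else 0)"
      by (simp add: block_run_snoc block_step_def block_def lab_def)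
    finally show ?case .
  qed
  have "acc_prob ?A x = (\<Sum>s\<in>F. block_run {..<m} cl s0 x s)" for x
  proof -
    have unit: "U None s i * cnj (U None s i) = (if i = s then 1 else 0)" if "s < m" "i < m" for s i
    proof -
      have "{t \<in> {..<m}. t = s} = {s}"
        using that by auto
      with modulus[OF that, of None] show ?thesis
        by (simp add: lab_def)
    qed
    have "(\<Sum>r\<in>acc ?A. mtrace m (mmult m (proj ?A None r) (rho_final ?A x))) =
        (\<Sum>s\<in>F. mtrace m (mmult m (\<lambda>i j. U None s i * cnj (U None s j)) (rho_final ?A x)))"
      unfolding basis_qfa_simps by (subst sum.reindex) (auto simp: inj_on_def)
    also have "\<dots> = (\<Sum>s\<in>F. complex_of_real (block_run {..<m} cl s0 x s))"
      using assms(2) by (intro sum.cong refl mtrace_diagonal_projector state unit) auto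
    finally show ?thesis
      by (simp add: acc_prob_def)
  qed
  with qfa show ?thesis by blast
qed

lemma block_approximable_LMO:
  assumes "block_approximable L"
  shows "L \<in> LMO"
proof -
  \<comment> \<open>Error 1/4 isolates the cut-point 1/2 with radius 1/4.\<close>
  have "(0::real) < 1 / 4" by simp
  with assms obtain m :: nat and cl s0 F where m: "s0 < m" "F \<subseteq> {..<m}"
    and acc: "\<And>x. x \<in> L \<Longrightarrow> 1 - 1 / 4 \<le> (\<Sum>s\<in>F. block_run {..<m} cl s0 x s)"
      "\<And>x. x \<notin> L \<Longrightarrow> (\<Sum>s\<in>F. block_run {..<m} cl s0 x s) \<le> 1 / 4"
    by (rule block_approximableE) (rule that)
  obtain A :: "'a mon_qfa" where A: "is_mon_qfa A"
    and prob: "\<And>x. acc_prob A x = (\<Sum>s\<in>F. block_run {..<m} cl s0 x s)"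
    using block_run_realizable[OF m, of cl] by blast
  have "x \<in> L \<longleftrightarrow> 1 / 2 < acc_prob A x" "1 / 4 \<le> \<bar>acc_prob A x - 1 / 2\<bar>" for x
    using acc[of x] unfolding prob[symmetric] by (cases "x \<in> L"; force)+
  then have "recognizes_isolated A L"
    unfolding recognizes_isolated_def by (intro exI[of _ "1 / 2"] exI[of _ "1 / 4"]) simp
  with A show ?thesis
    unfolding LMO_def by blast
qed

lemma liIdPT_subset_LMO: "liIdPT \<subseteq> LMO"
proof
  fix L :: "'a list set"
  assume "L \<in> liIdPT"
  then have "block_approximable L"
    unfolding liIdPT_def
    by (rule block_approximable_bool_closure) (auto intro: pattern_lang_block_approximable)
  then show "L \<in> LMO"
    by (rule block_approximable_LMO)
qed

theorem theorem6:
  shows "(LMO :: ('a::finite) list set set) = VJbar \<and> (VJbar :: 'a list set set) = liIdPT"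
  using LMO_subset_VJbar VJbar_subset_liIdPT liIdPT_subset_LMO by blast

end
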